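(* Let $G$ be a graph with $\alpha(G)\ge 3$. If $G$ has no induced subgraph isomorphic to $C_k$ for any $k$ with $4\le k\le 2\alpha(G)-1$, then $h(G)\ge \chi(G)$.
   Context: All graphs are finite, without loops or parallel edges. $C_k$ is the cycle on $k$ vertices; $\alpha(G)$ is the independence number and $\chi(G)$ the chromatic number of $G$. A graph $H$ is a minor of $G$ if $H$ can be obtained from a subgraph of $G$ by contracting edges. The Hadwiger number $h(G)$ is the largest integer $k$ such that the complete graph $K_k$ is a minor of $G$. *)

theory Defs
  imports "Graph_Theory.Graph_Theory"
begin

text \<open>
  A finite simple graph is a \<^typ>\<open>'a pair_pre_digraph\<close> satisfying \<^const>\<open>pair_graph\<close>:
  each edge is stored as both of its ordered pairs, and there are no loops.
\<close>

definition independent_set :: "'a pair_pre_digraph \<Rightarrow> 'a set \<Rightarrow> bool" where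
  "independent_set G S \<longleftrightarrow> S \<subseteq> pverts G \<and> (\<forall>u\<in>S. \<forall>v\<in>S. (u, v) \<notin> parcs G)"

definition independence_number :: "'a pair_pre_digraph \<Rightarrow> nat" where
  "independence_number G = Max {card S |S. independent_set G S}"

definition proper_colouring :: "'a pair_pre_digraph \<Rightarrow> nat \<Rightarrow> ('a \<Rightarrow> nat) \<Rightarrow> bool" where
  "proper_colouring G k c \<longleftrightarrow>
     (\<forall>v\<in>pverts G. c v < k) \<and> (\<forall>(u, v)\<in>parcs G. c u \<noteq> c v)"

definition chromatic_number :: "'a pair_pre_digraph \<Rightarrow> nat" where
  "chromatic_number G = (LEAST k. \<exists>c. proper_colouring G k c)"

definition complete_graph :: "nat \<Rightarrow> nat pair_pre_digraph" where
  "complete_graph k = \<lparr>pverts = {..<k}, parcs = {(i, j). i < k \<and> j < k \<and> i \<noteq> j}\<rparr>"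

text \<open>This is the cycle on \<open>k\<close> vertices only for \<open>k \<ge> 3\<close>.\<close>

definition cycle_graph :: "nat \<Rightarrow> nat pair_pre_digraph" where
  "cycle_graph k = \<lparr>pverts = {..<k},
     parcs = {(i, j). i < k \<and> j < k \<and> (j = Suc i mod k \<or> i = Suc j mod k)}\<rparr>"

text \<open>
  Contraction of the edge \<open>uv\<close>: the merged vertex is again called \<open>u\<close>; loops are discarded,
  and parallel edges are identified because the arcs form a set.
\<close>

definition contract_edge :: "'a pair_pre_digraph \<Rightarrow> 'a \<Rightarrow> 'a \<Rightarrow> 'a pair_pre_digraph" where
  "contract_edge G u v = (let f = (\<lambda>x. if x = v then u else x) in
     \<lparr>pverts = f ` pverts G, parcs = {(f x, f y) |x y. (x, y) \<in> parcs G \<and> f x \<noteq> f y}\<rparr>)"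

inductive contracts_to :: "'a pair_pre_digraph \<Rightarrow> 'a pair_pre_digraph \<Rightarrow> bool" where
  refl: "contracts_to G G"
| step: "contracts_to G H \<Longrightarrow> (u, v) \<in> parcs H \<Longrightarrow> contracts_to G (contract_edge H u v)"

definition graph_minor :: "'b pair_pre_digraph \<Rightarrow> 'a pair_pre_digraph \<Rightarrow> bool" where
  "graph_minor H G \<longleftrightarrow> (\<exists>S K :: 'a pair_pre_digraph. pair_graph S \<and>
     subgraph (with_proj S) (with_proj G) \<and> contracts_to S K \<and>
     digraph_iso (with_proj K) (with_proj H))"

definition hadwiger_number :: "'a pair_pre_digraph \<Rightarrow> nat" where
  "hadwiger_number G = Max {k. graph_minor (complete_graph k) G}"

lemma complete_digraph_complete_graph: "complete_digraph k (with_proj (complete_graph k))"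
  by (auto simp: complete_digraph_pair_def complete_graph_def)

lemma pair_graph_complete_graph: "pair_graph (complete_graph k)"
  by (rule pair_graphI_complete[OF complete_digraph_complete_graph])

lemma pair_graphI:
  assumes "finite (pverts G)" "parcs G \<subseteq> pverts G \<times> pverts G"
    and "\<And>u v. (u, v) \<in> parcs G \<Longrightarrow> (v, u) \<in> parcs G" "\<And>u. (u, u) \<notin> parcs G"
  shows "pair_graph G"
proof -
  have "finite (parcs G)" using assms(1,2) by (meson finite_SigmaI finite_subset)
  then show ?thesis using assms
    by unfold_locales (auto simp: symmetric_def intro!: symI)
qed

lemma pair_graph_cycle_graph:
  assumes "k \<ge> 3" shows "pair_graph (cycle_graph k)"
proof (rule pair_graphI)
  fix u show "(u, u) \<notin> parcs (cycle_graph k)"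
    using assms by (auto simp: cycle_graph_def mod_Suc)
qed (auto simp: cycle_graph_def)

lemma pair_graph_contract_edge:
  assumes "pair_graph G" "(u, v) \<in> parcs G"
  shows "pair_graph (contract_edge G u v)"
    and "pverts (contract_edge G u v) = pverts G - {v}"
proof -
  interpret pair_graph G by fact
  have [simp]: "u \<in> pverts G" "v \<in> pverts G" "u \<noteq> v"
    using assms(2) by (auto dest: in_arcsD1 in_arcsD2 no_loops')
  show "pverts (contract_edge G u v) = pverts G - {v}"
    by (auto simp: contract_edge_def)
  show "pair_graph (contract_edge G u v)"
  proof (rule pair_graphI)
    show "finite (pverts (contract_edge G u v))"
      using pair_finite_verts by (simp add: contract_edge_def)
    show "parcs (contract_edge G u v) \<subseteq>
        pverts (contract_edge G u v) \<times> pverts (contract_edge G u v)"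
      by (auto simp: contract_edge_def dest: in_arcsD1 in_arcsD2)
    fix x y
    let ?f = "\<lambda>x. if x = v then u else x"
    have C: "parcs (contract_edge G u v) =
        {(?f x, ?f y) |x y. (x, y) \<in> parcs G \<and> ?f x \<noteq> ?f y}"
      by (simp only: contract_edge_def Let_def pair_pre_digraph.select_convs)
    show "(y, x) \<in> parcs (contract_edge G u v)" if xy: "(x, y) \<in> parcs (contract_edge G u v)"
    proof -
      obtain a b where "x = ?f a" "y = ?f b" "(a, b) \<in> parcs G" "?f a \<noteq> ?f b"
        using xy unfolding C by blast
      then have "y = ?f b" "x = ?f a" "(b, a) \<in> parcs G" "?f b \<noteq> ?f a"
        using arcs_symmetric by (blast, blast, blast, metis)
      then show ?thesis unfolding C by blast
    qed
    show "(x, x) \<notin> parcs (contract_edge G u v)"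
      unfolding C by blast
  qed
qed

lemma contracts_to_pair_graph:
  assumes "contracts_to G H" "pair_graph G"
  shows "pair_graph H \<and> pverts H \<subseteq> pverts G"
  using assms by induction (auto simp: pair_graph_contract_edge)

lemma digraph_iso_pair_iff:
  assumes "pair_graph G" "pair_graph H"
  shows "digraph_iso (with_proj G) (with_proj H) \<longleftrightarrow>
    (\<exists>f. bij_betw f (pverts G) (pverts H) \<and>
      (\<forall>u\<in>pverts G. \<forall>v\<in>pverts G. (u, v) \<in> parcs G \<longleftrightarrow> (f u, f v) \<in> parcs H))"
  (is "?L \<longleftrightarrow> ?R")
proof
  interpret G: pair_graph G by fact
  assume ?L
  then obtain h where h: "pre_digraph.digraph_isomorphism (with_proj G) h"
    and H: "with_proj H = app_iso h (with_proj G)" by (auto simp: digraph_iso_def)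
  define f where "f = iso_verts h"
  have V: "pverts H = f ` pverts G" and A: "parcs H = iso_arcs h ` parcs G"
    and th: "iso_tail h = fst" "iso_head h = snd"
    using H by (auto simp: app_iso_def f_def with_proj_def)
  have inj: "inj_on f (pverts G)"
    and ends: "\<And>a. a \<in> parcs G \<Longrightarrow> iso_arcs h a = (f (fst a), f (snd a))"
    using h by (auto simp: G.digraph_isomorphism_def f_def th prod_eq_iff)
  have "(u, v) \<in> parcs G \<longleftrightarrow> (f u, f v) \<in> parcs H"
    if "u \<in> pverts G" "v \<in> pverts G" for u v
  proof
    assume "(u, v) \<in> parcs G"
    then show "(f u, f v) \<in> parcs H" using ends[of "(u, v)"] A by force
  next
    assume "(f u, f v) \<in> parcs H"
    then obtain a where a: "a \<in> parcs G" "(f u, f v) = iso_arcs h a" using A by auto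
    then have "f u = f (fst a)" "f v = f (snd a)" using ends[OF a(1)] by auto
    then have "u = fst a" "v = snd a"
      using inj that a(1) G.arc_fst_in_verts G.arc_snd_in_verts by (auto dest: inj_onD)
    then show "(u, v) \<in> parcs G" using a(1) by simp
  qed
  then show ?R using inj V by (auto simp: bij_betw_def)
next
  interpret G: pair_graph G by fact
  interpret H: pair_graph H by fact
  assume ?R
  then obtain f where f: "bij_betw f (pverts G) (pverts H)"
    and E: "\<And>u v. u \<in> pverts G \<Longrightarrow> v \<in> pverts G \<Longrightarrow> (u, v) \<in> parcs G \<longleftrightarrow> (f u, f v) \<in> parcs H"
    by blast
  define h where "h = \<lparr>iso_verts = f, iso_arcs = map_prod f f, iso_head = snd, iso_tail = fst\<rparr>"
  have inj: "inj_on f (pverts G)" and V: "f ` pverts G = pverts H"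
    using f by (auto simp: bij_betw_def)
  have sub: "parcs G \<subseteq> pverts G \<times> pverts G" by (auto dest: G.in_arcsD1 G.in_arcsD2)
  have "inj_on (map_prod f f) (parcs G)"
    using map_prod_inj_on[OF inj inj] sub by (rule inj_on_subset)
  then have "pre_digraph.digraph_isomorphism (with_proj G) h"
    using inj G.wf_digraph by (auto simp: G.digraph_isomorphism_def h_def)
  moreover have "map_prod f f ` parcs G = parcs H"
  proof (intro equalityI subsetI)
    fix a assume "a \<in> map_prod f f ` parcs G"
    then show "a \<in> parcs H" using E sub by auto
  next
    fix a assume a: "a \<in> parcs H"
    obtain x y where xy: "a = (x, y)" by force
    then have "x \<in> f ` pverts G" "y \<in> f ` pverts G"
      using a V by (auto dest: H.in_arcsD1 H.in_arcsD2)
    then show "a \<in> map_prod f f ` parcs G" using a E xy by force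
  qed
  then have "with_proj H = app_iso h (with_proj G)"
    by (simp add: app_iso_def h_def V with_proj_def)
  ultimately show ?L unfolding digraph_iso_def by blast
qed

text \<open>The extrema in the definitions above are attained for finite graphs.\<close>

lemma independence_number_wf:
  assumes "pair_graph G"
  shows "finite {card S |S. independent_set G S}" "{card S |S. independent_set G S} \<noteq> {}"
proof -
  interpret pair_graph G by fact
  have "{card S |S. independent_set G S} \<subseteq> card ` Pow (pverts G)"
    by (auto simp: independent_set_def)
  then show "finite {card S |S. independent_set G S}"
    using pair_finite_verts finite_subset by fast
  have "independent_set G {}" by (simp add: independent_set_def)
  then show "{card S |S. independent_set G S} \<noteq> {}" by auto
qed

lemma chromatic_number_wf:
  assumes "pair_graph G" shows "\<exists>k c. proper_colouring G k c"
proof -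
  interpret pair_graph G by fact
  obtain c where c: "bij_betw c (pverts G) {0..<card (pverts G)}"
    using ex_bij_betw_finite_nat[OF pair_finite_verts] by blast
  then have "proper_colouring G (card (pverts G)) c"
    unfolding proper_colouring_def bij_betw_def
    by (auto dest: inj_onD no_loops' in_arcsD1 in_arcsD2)
  then show ?thesis by blast
qed

lemma hadwiger_number_wf:
  assumes "pair_graph G"
  shows "finite {k. graph_minor (complete_graph k) G}" "{k. graph_minor (complete_graph k) G} \<noteq> {}"
proof -
  interpret pair_graph G by fact
  have "k \<le> card (pverts G)" if "graph_minor (complete_graph k) G" for k
  proof -
    from that obtain S K where S: "pair_graph S" "subgraph (with_proj S) (with_proj G)"
      "contracts_to S K" "digraph_iso (with_proj K) (with_proj (complete_graph k))"
      by (auto simp: graph_minor_def)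
    have K: "pair_graph K" "pverts K \<subseteq> pverts S"
      using contracts_to_pair_graph S by auto
    obtain f where "bij_betw f (pverts K) {..<k}"
      using S(4) digraph_iso_pair_iff[OF K(1) pair_graph_complete_graph]
      by (auto simp: complete_graph_def)
    then have "card (pverts K) = k" using bij_betw_same_card by fastforce
    moreover have "pverts K \<subseteq> pverts G" using K(2) S(2) by (auto simp: subgraph_def)
    ultimately show ?thesis using card_mono[OF pair_finite_verts] by blast
  qed
  then have "{k. graph_minor (complete_graph k) G} \<subseteq> {..card (pverts G)}" by auto
  then show "finite {k. graph_minor (complete_graph k) G}" by (rule finite_subset) simp
  define E :: "'a pair_pre_digraph" where "E = \<lparr>pverts = {}, parcs = {}\<rparr>"
  have E: "pair_graph E" by (rule pair_graphI) (auto simp: E_def)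
  then interpret E: pair_graph E .
  have "digraph_iso (with_proj E) (with_proj (complete_graph 0))"
    by (subst digraph_iso_pair_iff[OF E pair_graph_complete_graph])
      (auto simp: E_def complete_graph_def bij_betw_def)
  moreover have "subgraph (with_proj E) (with_proj G)"
    using wf_digraph E.wf_digraph by (simp add: subgraph_def compatible_def) (simp add: E_def)
  ultimately have "graph_minor (complete_graph 0) G"
    unfolding graph_minor_def using E contracts_to.refl by blast
  then show "{k. graph_minor (complete_graph k) G} \<noteq> {}" by blast
qed

end

theory Submission
  imports Defs
begin

text \<open>
  Write \<open>a = \<alpha>(G)\<close>. A hole of length \<open>k\<close> contains \<open>\<lfloor>k/2\<rfloor>\<close> pairwise nonadjacent vertices,
  so every hole has length \<open>2a\<close> or \<open>2a + 1\<close>, and by maximality of \<open>a\<close> a vertex outside a hole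
  has at least two neighbours on it, at least three if its length is \<open>2a + 1\<close>. Hence an even
  hole minus one vertex, or an odd hole minus two consecutive vertices, is a connected
  dominating set. A clique \<open>Q\<close> together with \<open>m\<close> disjoint connected dominating sets avoiding
  \<open>Q\<close> is a model of a complete minor on \<open>|Q| + m\<close> vertices, so it suffices to find such a
  configuration with \<open>\<chi>(G) \<le> |Q| + m\<close>. This is done by induction on induced subgraphs.
  Without holes the graph is chordal, and \<open>m = 0\<close> works because \<open>\<chi> = \<omega>\<close>. Otherwise delete a
  shortest hole \<open>C\<close>. As there are no shorter holes, each other vertex is complete to \<open>C\<close> or
  sees two or three consecutive vertices of \<open>C\<close>, and these arcs are so constrained
  by adjacency that the clique obtained for \<open>G - C\<close> has a common neighbour on \<open>C\<close>, and even two
  consecutive ones if \<open>C\<close> is odd. Adding these to the clique and the rest of \<open>C\<close> to the family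
  pays for the two, respectively three, colours that \<open>C\<close> needs.
\<close>

section \<open>Complete minors from branch sets\<close>

text \<open>Connectedness is encoded as a cut condition: every split into two nonempty parts is
  crossed by an edge. In this form it passes through the contraction of an edge without any handling
  of walks.\<close>

definition connected_set :: "('a \<Rightarrow> 'a \<Rightarrow> bool) \<Rightarrow> 'a set \<Rightarrow> bool" where
  "connected_set E X \<longleftrightarrow> X \<noteq> {} \<and>
     (\<forall>A B. A \<union> B = X \<and> A \<inter> B = {} \<and> A \<noteq> {} \<and> B \<noteq> {} \<longrightarrow> (\<exists>a\<in>A. \<exists>b\<in>B. E a b))"

lemma connected_set_singleton: "connected_set E {x}"
  by (auto simp: connected_set_def Un_singleton_iff)

lemma contracts_to_trans: "contracts_to H K \<Longrightarrow> contracts_to G H \<Longrightarrow> contracts_to G K"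
  by (induction rule: contracts_to.induct) (auto intro: contracts_to.step)

lemma contract_edge_arcI:
  assumes "(x, y) \<in> parcs G" "x' = (if x = v then u else x)" "y' = (if y = v then u else y)"
    "x' \<noteq> y'"
  shows "(x', y') \<in> parcs (contract_edge G u v)"
  using assms unfolding contract_edge_def Let_def by (simp only: pair_pre_digraph.select_convs) blast

text \<open>Induction on the number of vertices. Contracting an edge inside a class with at least
  two vertices keeps all classes connected, disjoint and pairwise adjacent; once every class is a
  single vertex, the graph itself is complete.\<close>

lemma contract_connected_partition:
  assumes "pair_graph S" "\<Union>P = pverts S"
    and "\<And>X Y. X \<in> P \<Longrightarrow> Y \<in> P \<Longrightarrow> X \<noteq> Y \<Longrightarrow> X \<inter> Y = {}"
    and "\<And>X. X \<in> P \<Longrightarrow> connected_set (\<lambda>u v. (u, v) \<in> parcs S) X"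
    and "\<And>X Y. X \<in> P \<Longrightarrow> Y \<in> P \<Longrightarrow> X \<noteq> Y \<Longrightarrow> \<exists>x\<in>X. \<exists>y\<in>Y. (x, y) \<in> parcs S"
  shows "\<exists>K. contracts_to S K \<and> card (pverts K) = card P \<and>
    (\<forall>u\<in>pverts K. \<forall>v\<in>pverts K. u \<noteq> v \<longrightarrow> (u, v) \<in> parcs K)"
  using assms
proof (induction "card (pverts S)" arbitrary: S P rule: less_induct)
  case less
  note disj = less.prems(3) and conn = less.prems(4) and touch = less.prems(5)
  have fS: "finite (pverts S)"
  proof -
    interpret pair_graph S by (rule less.prems(1))
    show ?thesis by (rule pair_finite_verts)
  qed
  have ne: "X \<noteq> {}" if "X \<in> P" for X using conn[OF that] by (simp add: connected_set_def)
  show ?case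
  proof (cases "\<forall>X\<in>P. \<forall>x\<in>X. \<forall>y\<in>X. x = y")
    case True
    have sing: "X = {x}" if "X \<in> P" "x \<in> X" for X x using True that by blast
    have P: "P = (\<lambda>x. {x}) ` pverts S"
    proof (intro equalityI subsetI)
      fix X assume X: "X \<in> P"
      then obtain x where "x \<in> X" using ne by blast
      then show "X \<in> (\<lambda>x. {x}) ` pverts S" using sing[OF X] X less.prems(2) by blast
    next
      fix X assume "X \<in> (\<lambda>x. {x}) ` pverts S"
      then obtain x Y where "X = {x}" "x \<in> Y" "Y \<in> P" using less.prems(2) by blast
      then show "X \<in> P" using sing by blast
    qed
    have "card P = card (pverts S)" unfolding P by (rule card_image) simp
    moreover have "(u, v) \<in> parcs S" if "u \<in> pverts S" "v \<in> pverts S" "u \<noteq> v" for u v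
      using touch[of "{u}" "{v}"] that P by auto
    ultimately show ?thesis using contracts_to.refl by metis
  next
    case False
    then obtain X u y where X: "X \<in> P" "u \<in> X" "y \<in> X" "u \<noteq> y" by blast
    \<comment> \<open>Splitting \<open>X\<close> into \<open>u\<close> and the rest makes
      connectedness yield an edge \<open>uv\<close> inside \<open>X\<close>, which is the one to
      contract.\<close>
    have "{u} \<union> (X - {u}) = X" "{u} \<inter> (X - {u}) = {}" "{u} \<noteq> {}" "X - {u} \<noteq> {}"
      using X by auto
    then obtain v where v: "v \<in> X" "v \<noteq> u" "(u, v) \<in> parcs S"
      using conn[OF X(1)] unfolding connected_set_def by blast
    define S' where "S' = contract_edge S u v"
    have S': "pair_graph S'" "pverts S' = pverts S - {v}"
      using pair_graph_contract_edge[OF less.prems(1) v(3)] by (simp_all add: S'_def)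
    have vS: "v \<in> pverts S" using v X less.prems(2) by blast
    have arc: "(x', y') \<in> parcs S'"
      if "(x, y) \<in> parcs S" "x' = (if x = v then u else x)" "y' = (if y = v then u else y)"
        "x' \<noteq> y'" for x y x' y'
      unfolding S'_def by (rule contract_edge_arcI[OF that])
    define X' where "X' = X - {v}"
    define P' where "P' = insert X' (P - {X})"
    have X': "u \<in> X'" "X' \<subseteq> X" using X v by (auto simp: X'_def)
    have XY: "X \<inter> Y = {}" if "Y \<in> P - {X}" for Y using disj[of X Y] X that by blast
    have vY: "v \<notin> Y" if "Y \<in> P - {X}" for Y using XY[OF that] v by blast
    have "card (pverts S') < card (pverts S)"
      unfolding S'(2) using fS vS by (rule card_Diff1_less)
    moreover have "\<Union>P' = pverts S'"
      unfolding S'(2) less.prems(2)[symmetric] P'_def using X' vY X by (auto simp: X'_def)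
    moreover have "Y \<inter> Z = {}" if "Y \<in> P'" "Z \<in> P'" "Y \<noteq> Z" for Y Z
      using that XY X'(2) disj[of Y Z] unfolding P'_def by blast
    moreover have "connected_set (\<lambda>u v. (u, v) \<in> parcs S') Y" if "Y \<in> P'" for Y
    proof (cases "Y = X'")
      case True
      \<comment> \<open>A cut of \<open>X'\<close> is lifted to \<open>X\<close> by placing
        \<open>v\<close> on the side of \<open>u\<close>. An edge across the lifted cut does not
        join \<open>u\<close> to \<open>v\<close>, so its image still crosses the cut.\<close>
      have "\<exists>a\<in>A. \<exists>b\<in>B. (a, b) \<in> parcs S'"
        if AB: "A \<union> B = X'" "A \<inter> B = {}" "A \<noteq> {}" "B \<noteq> {}" for A B
      proof (cases "u \<in> A")
        case True
        have "insert v A \<union> B = X" "insert v A \<inter> B = {}" "insert v A \<noteq> {}"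
          using AB v by (auto simp: X'_def)
        then obtain a b where ab: "a \<in> insert v A" "b \<in> B" "(a, b) \<in> parcs S"
          using conn[OF X(1)] AB(4) unfolding connected_set_def by blast
        define a' where "a' = (if a = v then u else a)"
        have "a' \<in> A" using ab True by (auto simp: a'_def)
        moreover have "b \<noteq> v" using ab AB by (auto simp: X'_def)
        ultimately have "(a', b) \<in> parcs S'" using ab AB by (intro arc[OF ab(3) a'_def]) auto
        then show ?thesis using \<open>a' \<in> A\<close> ab by blast
      next
        case False
        then have uB: "u \<in> B" using AB X' by blast
        have "A \<union> insert v B = X" "A \<inter> insert v B = {}" "insert v B \<noteq> {}"
          using AB v by (auto simp: X'_def)
        then obtain a b where ab: "a \<in> A" "b \<in> insert v B" "(a, b) \<in> parcs S"
          using conn[OF X(1)] AB(3) unfolding connected_set_def by blast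
        define b' where "b' = (if b = v then u else b)"
        have "b' \<in> B" using ab uB by (auto simp: b'_def)
        moreover have "a \<noteq> v" using ab AB by (auto simp: X'_def)
        ultimately have "(a, b') \<in> parcs S'" using ab AB by (intro arc[OF ab(3) _ b'_def]) auto
        then show ?thesis using \<open>b' \<in> B\<close> ab by blast
      qed
      then show ?thesis using X' True unfolding connected_set_def by blast
    next
      case False
      then have Y: "Y \<in> P - {X}" using that by (simp add: P'_def)
      have "\<exists>a\<in>A. \<exists>b\<in>B. (a, b) \<in> parcs S'"
        if AB: "A \<union> B = Y" "A \<inter> B = {}" "A \<noteq> {}" "B \<noteq> {}" for A B
      proof -
        obtain a b where ab: "a \<in> A" "b \<in> B" "(a, b) \<in> parcs S"
          using conn[of Y] Y AB unfolding connected_set_def by blast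
        then have "(a, b) \<in> parcs S'" using vY[OF Y] AB by (intro arc[OF ab(3)]) auto
        then show ?thesis using ab by blast
      qed
      then show ?thesis using ne[of Y] Y unfolding connected_set_def by blast
    qed
    moreover have "\<exists>x\<in>Y. \<exists>y\<in>Z. (x, y) \<in> parcs S'" if YZ: "Y \<in> P'" "Z \<in> P'" "Y \<noteq> Z" for Y Z
    proof -
      \<comment> \<open>\<open>ex\<close> recovers the class before the contraction. An edge between
        two old classes stays an edge, because its ends are mapped into disjoint new
        classes.\<close>
      define ex where "ex Y = (if Y = X' then X else Y)" for Y
      have exP: "ex W \<in> P" "\<And>x. x \<in> ex W \<Longrightarrow> (if x = v then u else x) \<in> W" if "W \<in> P'" for W
        using that X X' vY by (auto simp: ex_def P'_def X'_def split: if_splits)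
      have "ex Y \<noteq> ex Z" using YZ by (auto simp: ex_def P'_def split: if_splits)
      then obtain x y where xy: "x \<in> ex Y" "y \<in> ex Z" "(x, y) \<in> parcs S"
        using touch[OF exP(1)[OF YZ(1)] exP(1)[OF YZ(2)]] by blast
      define x' where "x' = (if x = v then u else x)"
      define y' where "y' = (if y = v then u else y)"
      have in': "x' \<in> Y" "y' \<in> Z"
        unfolding x'_def y'_def using exP(2)[OF YZ(1) xy(1)] exP(2)[OF YZ(2) xy(2)] .
      have "Y \<inter> Z = {}" using YZ XY X'(2) disj[of Y Z] unfolding P'_def by blast
      then have "x' \<noteq> y'" using in' by blast
      then show ?thesis using arc[OF xy(3) x'_def y'_def] in' by blast
    qed
    ultimately obtain K where K: "contracts_to S' K" "card (pverts K) = card P'"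
      "\<forall>u\<in>pverts K. \<forall>v\<in>pverts K. u \<noteq> v \<longrightarrow> (u, v) \<in> parcs K"
      using less.hyps[of S' P'] S'(1) by blast
    have "contracts_to S S'" unfolding S'_def by (rule contracts_to.step[OF contracts_to.refl v(3)])
    then have "contracts_to S K" using contracts_to_trans K(1) by blast
    moreover have "finite P" using fS less.prems(2) by (metis finite_UnionD)
    moreover have "X' \<notin> P - {X}" using XY[of X'] X' by blast
    ultimately show ?thesis using K X card_Suc_Diff1[of P X] unfolding P'_def by auto
  qed
qed

text \<open>In the subgraph induced by \<open>\<Union>P\<close> the branch sets form a partition of
  the vertex set, so contracting each of them to a point leaves a complete graph on
  \<open>card P\<close> vertices.\<close>

lemma complete_minor_of_branch_sets:
  assumes G: "pair_graph G" and V: "\<Union>P \<subseteq> pverts G"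
    and disj: "\<And>X Y. X \<in> P \<Longrightarrow> Y \<in> P \<Longrightarrow> X \<noteq> Y \<Longrightarrow> X \<inter> Y = {}"
    and conn: "\<And>X. X \<in> P \<Longrightarrow> connected_set (\<lambda>u v. (u, v) \<in> parcs G) X"
    and touch: "\<And>X Y. X \<in> P \<Longrightarrow> Y \<in> P \<Longrightarrow> X \<noteq> Y \<Longrightarrow> \<exists>x\<in>X. \<exists>y\<in>Y. (x, y) \<in> parcs G"
  shows "graph_minor (complete_graph (card P)) G"
proof -
  interpret G: pair_graph G by (rule G)
  define S where "S = \<lparr>pverts = \<Union>P, parcs = parcs G \<inter> \<Union>P \<times> \<Union>P\<rparr>"
  have S: "pair_graph S"
  proof (rule pair_graphI)
    show "finite (pverts S)" using finite_subset[OF V G.pair_finite_verts] by (simp add: S_def)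
  qed (auto simp: S_def G.arcs_symmetric dest: G.no_loops')
  then interpret S: pair_graph S .
  have sub: "subgraph (with_proj S) (with_proj G)"
    using G.wf_digraph S.wf_digraph V by (simp add: subgraph_def compatible_def) (auto simp: S_def)
  have inS: "(x, y) \<in> parcs S" if "(x, y) \<in> parcs G" "x \<in> \<Union>P" "y \<in> \<Union>P" for x y
    using that by (simp add: S_def)
  have "connected_set (\<lambda>u v. (u, v) \<in> parcs S) X" if X: "X \<in> P" for X
  proof -
    have "\<exists>a\<in>A. \<exists>b\<in>B. (a, b) \<in> parcs S"
      if AB: "A \<union> B = X" "A \<inter> B = {}" "A \<noteq> {}" "B \<noteq> {}" for A B
    proof -
      obtain a b where ab: "a \<in> A" "b \<in> B" "(a, b) \<in> parcs G"
        using conn[OF X] AB unfolding connected_set_def by blast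
      moreover have "a \<in> \<Union>P" "b \<in> \<Union>P" using ab X AB by auto
      ultimately show ?thesis using inS by blast
    qed
    then show ?thesis using conn[OF X] unfolding connected_set_def by blast
  qed
  moreover have "\<exists>x\<in>X. \<exists>y\<in>Y. (x, y) \<in> parcs S" if XY: "X \<in> P" "Y \<in> P" "X \<noteq> Y" for X Y
  proof -
    obtain x y where xy: "x \<in> X" "y \<in> Y" "(x, y) \<in> parcs G" using touch[OF XY] by blast
    moreover have "x \<in> \<Union>P" "y \<in> \<Union>P" using xy XY by auto
    ultimately show ?thesis using inS by blast
  qed
  moreover have "\<Union>P = pverts S" by (simp add: S_def)
  ultimately obtain K where K: "contracts_to S K" "card (pverts K) = card P"
    "\<forall>u\<in>pverts K. \<forall>v\<in>pverts K. u \<noteq> v \<longrightarrow> (u, v) \<in> parcs K"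
    using contract_connected_partition[OF S _ disj, of P] by blast
  have pK: "pair_graph K" using contracts_to_pair_graph[OF K(1) S] by blast
  then interpret K: pair_graph K .
  obtain f where f: "bij_betw f (pverts K) {..<card P}"
    using ex_bij_betw_finite_nat[OF K.pair_finite_verts] K(2) by (auto simp: lessThan_atLeast0)
  have "(u, v) \<in> parcs K \<longleftrightarrow> (f u, f v) \<in> parcs (complete_graph (card P))"
    if "u \<in> pverts K" "v \<in> pverts K" for u v
  proof (cases "u = v")
    case True
    then show ?thesis by (auto simp: complete_graph_def dest: K.no_loops')
  next
    case False
    then have "f u \<noteq> f v" "f u < card P" "f v < card P"
      using f that by (auto simp: bij_betw_def dest: inj_onD)
    then show ?thesis using K(3) that False by (auto simp: complete_graph_def)
  qed
  then have "digraph_iso (with_proj K) (with_proj (complete_graph (card P)))"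
    using f by (subst digraph_iso_pair_iff[OF pK pair_graph_complete_graph])
      (auto simp: complete_graph_def)
  then show ?thesis unfolding graph_minor_def using S sub K(1) by blast
qed

section \<open>Holes\<close>

lemma dvd_small_iff: "\<bar>x\<bar> < k \<Longrightarrow> k dvd x \<longleftrightarrow> x = 0" for k x :: int
  using zdvd_not_zless[of x k] zdvd_not_zless[of "-x" k] by (cases "x > 0"; cases "x < 0") auto

text \<open>Indices less than a period apart differ by at most \<open>k\<close> even after a shift
  by one, so this turns the divisibility conditions of a hole into linear arithmetic.\<close>

lemma dvd_le_iff: "\<bar>x\<bar> \<le> k \<Longrightarrow> k > 0 \<Longrightarrow> k dvd x \<longleftrightarrow> x = 0 \<or> \<bar>x\<bar> = k" for k x :: int
  using dvd_small_iff[of x k] by (cases "\<bar>x\<bar> < k") auto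

text \<open>A walk of least length: a repeated vertex or a forward chord would shorten it.\<close>

lemma induced_path:
  assumes "(x, y) \<in> R\<^sup>*"
  shows "\<exists>n f. f 0 = x \<and> f n = y \<and> (\<forall>i<n. (f i, f (Suc i)) \<in> R) \<and>
    (\<forall>i j. i < j \<and> j \<le> n \<longrightarrow> f i \<noteq> f j) \<and>
    (\<forall>i j. Suc i < j \<and> j \<le> n \<longrightarrow> (f i, f j) \<notin> R)"
proof -
  define n where "n = (LEAST n. (x, y) \<in> R ^^ n)"
  have ex: "\<exists>n. (x, y) \<in> R ^^ n" using assms by (simp add: rtrancl_power)
  have "(x, y) \<in> R ^^ n" unfolding n_def using ex by (rule LeastI_ex)
  then obtain f where f: "f 0 = x" "f n = y" "\<And>i. i < n \<Longrightarrow> (f i, f (Suc i)) \<in> R"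
    by (auto simp: relpow_fun_conv)
  have least: "m \<ge> n" if "(x, y) \<in> R ^^ m" for m
    unfolding n_def by (rule Least_le[of "\<lambda>n. (x, y) \<in> R ^^ n", OF that])
  have seg: "(f i, f j) \<in> R ^^ (j - i)" if "i \<le> j" "j \<le> n" for i j
    using that f(3) by (auto simp: relpow_fun_conv intro!: exI[of _ "\<lambda>t. f (i + t)"])
  have ne: "f i \<noteq> f j" if "i < j" "j \<le> n" for i j
  proof
    assume "f i = f j"
    then have "(x, y) \<in> R ^^ (i + (n - j))"
      using seg[of 0 i] seg[of j n] f(1,2) that unfolding relpow_add by auto
    from least[OF this] show False using that by simp
  qed
  have nr: "(f i, f j) \<notin> R" if "Suc i < j" "j \<le> n" for i j
  proof
    assume a: "(f i, f j) \<in> R"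
    have "(x, f j) \<in> R ^^ Suc i" using seg[of 0 i] a f that by auto
    then have "(x, y) \<in> R ^^ (Suc i + (n - j))"
      using seg[of j n] f that unfolding relpow_add by auto
    from least[OF this] show False using that by simp
  qed
  show ?thesis using f ne nr by blast
qed

section \<open>Graphs as symmetric irreflexive relations, cliques, stable sets and holes\<close>

locale adjacency =
  fixes E :: "'a \<Rightarrow> 'a \<Rightarrow> bool"
  assumes adj_sym: "E u v \<Longrightarrow> E v u" and adj_irrefl: "\<not> E v v"
begin

definition clique :: "'a set \<Rightarrow> bool" where
  "clique Q \<longleftrightarrow> (\<forall>u\<in>Q. \<forall>v\<in>Q. u \<noteq> v \<longrightarrow> E u v)"

definition stable :: "'a set \<Rightarrow> bool" where
  "stable S \<longleftrightarrow> (\<forall>u\<in>S. \<forall>v\<in>S. \<not> E u v)"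

definition colourable :: "'a set \<Rightarrow> nat \<Rightarrow> bool" where
  "colourable U n \<longleftrightarrow> (\<exists>f. (\<forall>v\<in>U. f v < n) \<and> (\<forall>u\<in>U. \<forall>v\<in>U. E u v \<longrightarrow> f u \<noteq> f v))"

definition dominates :: "'a set \<Rightarrow> 'a set \<Rightarrow> bool" where
  "dominates R V \<longleftrightarrow> (\<forall>v\<in>V - R. \<exists>r\<in>R. E v r)"

definition simplicial :: "'a set \<Rightarrow> 'a \<Rightarrow> bool" where
  "simplicial U z \<longleftrightarrow> z \<in> U \<and> clique {u\<in>U. E z u}"

text \<open>The vertices of a hole are indexed \<open>k\<close>-periodically by the integers, so that a rotation is
  a translation of the index.\<close>

definition hole :: "int \<Rightarrow> (int \<Rightarrow> 'a) \<Rightarrow> bool" where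
  "hole k c \<longleftrightarrow> k \<ge> 4 \<and> (\<forall>i j. c i = c j \<longleftrightarrow> k dvd i - j) \<and>
     (\<forall>i j. E (c i) (c j) \<longleftrightarrow> k dvd i - j - 1 \<or> k dvd i - j + 1)"

definition hole_free :: "'a set \<Rightarrow> bool" where
  "hole_free U \<longleftrightarrow> (\<forall>k c. hole k c \<longrightarrow> \<not> range c \<subseteq> U)"

lemma hole_eq_iff: "hole k c \<Longrightarrow> \<bar>i - j\<bar> < k \<Longrightarrow> c i = c j \<longleftrightarrow> i = j"
  by (simp add: hole_def dvd_small_iff)

lemma hole_adj_iff:
  assumes "hole k c" "\<bar>i - j\<bar> < k"
  shows "E (c i) (c j) \<longleftrightarrow> \<bar>i - j\<bar> = 1 \<or> \<bar>i - j\<bar> = k - 1"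
proof -
  have "k \<ge> 4" using assms by (simp add: hole_def)
  then have "k dvd i - j - 1 \<longleftrightarrow> i - j - 1 = 0 \<or> \<bar>i - j - 1\<bar> = k"
    "k dvd i - j + 1 \<longleftrightarrow> i - j + 1 = 0 \<or> \<bar>i - j + 1\<bar> = k"
    using assms(2) by (intro dvd_le_iff; linarith)+
  moreover have "E (c i) (c j) \<longleftrightarrow> k dvd i - j - 1 \<or> k dvd i - j + 1"
    using assms(1) by (simp add: hole_def)
  ultimately show ?thesis using assms(2) \<open>k \<ge> 4\<close> by linarith
qed

lemma hole_periodic: "hole k c \<Longrightarrow> c (i + k * t) = c i"
  by (simp add: hole_def)

lemma hole_period: "hole k c \<Longrightarrow> c (i + k) = c i" "hole k c \<Longrightarrow> c (i - k) = c i"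
  by (simp_all add: hole_def)

lemma hole_next: "hole k c \<Longrightarrow> E (c i) (c (i + 1))" "hole k c \<Longrightarrow> E (c (i + 1)) (c i)"
  by (simp_all add: hole_def)

text \<open>Every index has a representative in a prescribed window of one period, so the window can
  start wherever the argument at hand needs it.\<close>

lemma hole_shift: "hole k c \<Longrightarrow> \<exists>j. p \<le> j \<and> j < p + k \<and> c i = c j"
proof -
  assume h: "hole k c"
  have "k > 0" using h by (simp add: hole_def)
  have "c i = c (p + (i - p) mod k)"
    using h by (simp add: hole_def) (metis diff_diff_eq dvd_minus_mod)
  then show ?thesis using \<open>k > 0\<close> by (intro exI[of _ "p + (i - p) mod k"]) auto
qed

lemma hole_range: "hole k c \<Longrightarrow> range c = c ` {p..<p + k}"
  using hole_shift[of k c p] by force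

lemma hole_finite: "hole k c \<Longrightarrow> finite (range c)"
  using hole_range[of k c 0] by simp

text \<open>Builds a hole from a list of \<open>n\<close> vertices, extended periodically by
  reduction modulo \<open>n\<close>. By symmetry only pairs \<open>i < j\<close> have to be
  checked.\<close>

lemma holeI:
  fixes w :: "int \<Rightarrow> 'a"
  assumes n: "n \<ge> 4"
    and inj: "\<And>i j. 0 \<le> i \<Longrightarrow> i < j \<Longrightarrow> j < n \<Longrightarrow> w i \<noteq> w j"
    and adj: "\<And>i j. 0 \<le> i \<Longrightarrow> i < j \<Longrightarrow> j < n \<Longrightarrow>
      E (w i) (w j) \<longleftrightarrow> j = i + 1 \<or> i = 0 \<and> j = n - 1"
  shows "hole n (\<lambda>i. w (i mod n))"
proof -
  have *: "n dvd i - j + d \<longleftrightarrow> n dvd i mod n - j mod n + d" for i j d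
  proof -
    have "i - j + d = i mod n - j mod n + d + (i div n - j div n) * n"
      by (simp add: algebra_simps minus_mult_div_eq_mod[symmetric])
    then show ?thesis by (metis dvd_add_times_triv_right_iff)
  qed
  have inj': "w i = w j \<longleftrightarrow> i = j" if "0 \<le> i" "i < n" "0 \<le> j" "j < n" for i j
    using inj[of i j] inj[of j i] that by (cases i j rule: linorder_cases) auto
  have adj': "E (w i) (w j) \<longleftrightarrow> n dvd i - j - 1 \<or> n dvd i - j + 1"
    if "0 \<le> i" "i < n" "0 \<le> j" "j < n" for i j
  proof -
    have "n dvd i - j - 1 \<longleftrightarrow> i - j - 1 = 0 \<or> \<bar>i - j - 1\<bar> = n"
      "n dvd i - j + 1 \<longleftrightarrow> i - j + 1 = 0 \<or> \<bar>i - j + 1\<bar> = n"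
      using n that by (intro dvd_le_iff; linarith)+
    moreover have "E (w i) (w j) \<longleftrightarrow> E (w j) (w i)" using adj_sym by blast
    ultimately show ?thesis
      using adj[of i j] adj[of j i] that n adj_irrefl
      by (cases i j rule: linorder_cases) auto
  qed
  have "w (i mod n) = w (j mod n) \<longleftrightarrow> n dvd i - j" for i j
    using inj'[of "i mod n" "j mod n"] n by (simp add: mod_eq_dvd_iff)
  moreover have "E (w (i mod n)) (w (j mod n)) \<longleftrightarrow> n dvd i - j - 1 \<or> n dvd i - j + 1" for i j
    using adj'[of "i mod n" "j mod n"] n *[of i j 1] *[of i j "-1"] by simp
  ultimately show ?thesis using n by (simp add: hole_def)
qed

text \<open>The cycle is \<open>v\<close> followed by the segment from \<open>c p\<close> to
  \<open>c q\<close>, of which \<open>v\<close> sees only the ends. The bound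
  \<open>q - p \<le> k - 2\<close> keeps the segment induced, and \<open>2 \<le> q - p\<close> gives
  length at least four.\<close>

lemma hole_chord:
  assumes h: "hole k c" and v: "v \<notin> range c" "E v (c p)" "E v (c q)"
    and pq: "2 \<le> q - p" "q - p \<le> k - 2" and no: "\<And>i. p < i \<Longrightarrow> i < q \<Longrightarrow> \<not> E v (c i)"
  shows "\<exists>d. hole (q - p + 2) d \<and> range d \<subseteq> insert v (range c)"
proof -
  define w where "w i = (if i = 0 then v else c (p + i - 1))" for i
  have "hole (q - p + 2) (\<lambda>i. w (i mod (q - p + 2)))"
  proof (rule holeI)
    fix i j :: int assume ij: "0 \<le> i" "i < j" "j < q - p + 2"
    show "w i \<noteq> w j" using hole_eq_iff[OF h, of "p+i-1" "p+j-1"] v ij pq by (auto simp: w_def)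
    show "E (w i) (w j) \<longleftrightarrow> j = i + 1 \<or> i = 0 \<and> j = q - p + 2 - 1"
    proof (cases "i = 0")
      case True
      have "E v (c (p + j - 1)) \<longleftrightarrow> j = 1 \<or> j = q - p + 1"
        using v no[of "p + j - 1"] ij True
        by (cases "j = 1"; cases "j = q - p + 1") auto
      then show ?thesis using True ij by (auto simp: w_def)
    next
      case False
      then show ?thesis using hole_adj_iff[OF h, of "p+i-1" "p+j-1"] ij pq by (auto simp: w_def)
    qed
  qed (use pq in auto)
  then show ?thesis by (intro exI conjI) (auto simp: w_def)
qed

text \<open>The cycle runs through \<open>v\<close>, the segment from \<open>c p\<close> to
  \<open>c q\<close>, and \<open>w\<close>, closing with the edge \<open>vw\<close>. Since
  \<open>v\<close> sees only the first and \<open>w\<close> only the last vertex of the segment, it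
  has no chord.\<close>

lemma hole_detour:
  assumes h: "hole k c" and v: "v \<notin> range c" "E v (c p)" and w: "w \<notin> range c" "E w (c q)"
    and vw: "E v w" and pq: "1 \<le> q - p" "q - p \<le> k - 2"
    and nov: "\<And>i. p < i \<Longrightarrow> i \<le> q \<Longrightarrow> \<not> E v (c i)"
    and now: "\<And>i. p \<le> i \<Longrightarrow> i < q \<Longrightarrow> \<not> E w (c i)"
  shows "\<exists>d. hole (q - p + 3) d \<and> range d \<subseteq> insert v (insert w (range c))"
proof -
  define f where "f i = (if i = 0 then v else if i = q - p + 2 then w else c (p + i - 1))" for i
  have "v \<noteq> w" using vw adj_irrefl by auto
  have "hole (q - p + 3) (\<lambda>i. f (i mod (q - p + 3)))"
  proof (rule holeI)
    fix i j :: int assume ij: "0 \<le> i" "i < j" "j < q - p + 3"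
    show "f i \<noteq> f j" using hole_eq_iff[OF h, of "p+i-1" "p+j-1"] v w \<open>v \<noteq> w\<close> ij pq
      by (auto simp: f_def)
    show "E (f i) (f j) \<longleftrightarrow> j = i + 1 \<or> i = 0 \<and> j = q - p + 3 - 1"
    proof (cases "i = 0")
      case True
      have "E v (c (p + j - 1)) \<longleftrightarrow> j = 1" if "j < q - p + 2"
        using v nov[of "p + j - 1"] ij True that by (cases "j = 1") auto
      then show ?thesis using True ij vw pq by (auto simp: f_def)
    next
      case i: False
      show ?thesis
      proof (cases "j = q - p + 2")
        case True
        have "E w (c (p + i - 1)) \<longleftrightarrow> i = q - p + 1"
          using w now[of "p + i - 1"] ij True i by (cases "i = q - p + 1") auto
        then show ?thesis using True i ij adj_sym by (auto simp: f_def)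
      next
        case False
        then show ?thesis using i hole_adj_iff[OF h, of "p+i-1" "p+j-1"] ij pq
          by (auto simp: f_def)
      qed
    qed
  qed (use pq in auto)
  then show ?thesis by (intro exI conjI) (auto simp: f_def)
qed

text \<open>These are every second vertex from \<open>c (p + 1)\<close> on. Their indices differ by
  even numbers of size at most \<open>k - 2\<close>, hence never by \<open>1\<close> or
  \<open>k - 1\<close>.\<close>

lemma stable_alternate:
  assumes h: "hole k c" and n: "2 * int n \<le> k"
  shows "stable ((\<lambda>j. c (p + 1 + 2 * int j)) ` {..<n})"
    "card ((\<lambda>j. c (p + 1 + 2 * int j)) ` {..<n}) = n"
proof -
  show "stable ((\<lambda>j. c (p + 1 + 2 * int j)) ` {..<n})"
    unfolding stable_def
  proof (intro ballI; elim imageE)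
    fix u v i j assume uv: "u = c (p + 1 + 2 * int i)" "v = c (p + 1 + 2 * int j)"
      and ij: "i \<in> {..<n}" "j \<in> {..<n}"
    define x where "x = \<bar>int i - int j\<bar>"
    have x: "\<bar>p + 1 + 2 * int i - (p + 1 + 2 * int j)\<bar> = 2 * x" unfolding x_def by arith
    have "x \<le> int n - 1" using ij unfolding x_def by auto
    then have "2 * x < k" "2 * x \<noteq> k - 1" using n by auto
    moreover have "2 * x \<noteq> 1" by presburger
    ultimately show "\<not> E u v"
      using hole_adj_iff[OF h, of "p + 1 + 2 * int i" "p + 1 + 2 * int j"]
      unfolding uv x by blast
  qed
  have "inj_on (\<lambda>j. c (p + 1 + 2 * int j)) {..<n}"
  proof (rule inj_onI)
    fix i j assume "i \<in> {..<n}" "j \<in> {..<n}" "c (p + 1 + 2 * int i) = c (p + 1 + 2 * int j)"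
    then show "i = j"
      using hole_eq_iff[OF h, of "p + 1 + 2 * int i" "p + 1 + 2 * int j"] n by auto
  qed
  then show "card ((\<lambda>j. c (p + 1 + 2 * int j)) ` {..<n}) = n" by (simp add: card_image)
qed

section \<open>Colouring chordal graphs\<close>

text \<open>A shortest path from \<open>x\<close> to \<open>y\<close> with interior in
  \<open>W\<close> is induced, and \<open>v\<close> sees only its two ends. It has at least two
  edges as \<open>x\<close> and \<open>y\<close> are nonadjacent, so \<open>v\<close> closes it to a
  cycle of length at least four without chords.\<close>

lemma hole_through_component:
  assumes R: "R = {(s, t). E s t \<and> s \<in> insert x (insert y W) \<and> t \<in> insert x (insert y W)}"
    and xy: "(x, y) \<in> R\<^sup>*" "x \<noteq> y" "\<not> E x y"
    and v: "E v x" "E v y" "v \<notin> W" "\<And>w. w \<in> W \<Longrightarrow> \<not> E v w"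
  shows "\<exists>k c. hole k c \<and> range c \<subseteq> insert v (insert x (insert y W))"
proof -
  obtain n f where path: "f 0 = x" "f n = y" "\<forall>i<n. (f i, f (Suc i)) \<in> R"
    "\<forall>i j. i < j \<and> j \<le> n \<longrightarrow> f i \<noteq> f j"
    "\<forall>i j. Suc i < j \<and> j \<le> n \<longrightarrow> (f i, f j) \<notin> R"
    using induced_path[OF xy(1)] by (elim exE conjE)
  have f: "f 0 = x" "f n = y" "\<And>i. i < n \<Longrightarrow> (f i, f (Suc i)) \<in> R"
    and ne: "\<And>i j. i < j \<Longrightarrow> j \<le> n \<Longrightarrow> f i \<noteq> f j"
    and nr: "\<And>i j. Suc i < j \<Longrightarrow> j \<le> n \<Longrightarrow> (f i, f j) \<notin> R"
    using path by simp_all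
  have "n \<noteq> 0" using f xy by (cases n) auto
  moreover have "n \<noteq> 1"
  proof
    assume "n = 1"
    then show False using f(3)[of 0] f(1,2) xy by (simp add: R)
  qed
  ultimately have n: "n \<ge> 2" by simp
  have fin: "f i \<in> insert x (insert y W)" if "i \<le> n" for i
    using that f(1,2) f(3)[of i] by (cases "i = n") (auto simp: R)
  have inn: "f i \<in> W" if "0 < i" "i < n" for i
    using ne[of 0 i] ne[of i n] fin[of i] that f by auto
  have vne: "v \<noteq> f i" if "i \<le> n" for i
    using fin[OF that] v adj_irrefl by auto
  have vadj: "E v (f i) \<longleftrightarrow> i = 0 \<or> i = n" if "i \<le> n" for i
    using inn[of i] v that f by (cases "i = 0"; cases "i = n") auto
  have fadj: "E (f i) (f j) \<longleftrightarrow> j = Suc i" if "i < j" "j \<le> n" for i j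
    using nr[of i j] f(3)[of i] fin[of i] fin[of j] that by (cases "j = Suc i") (auto simp: R)
  \<comment> \<open>Position \<open>0\<close> is \<open>v\<close> and position
    \<open>i \<ge> 1\<close> is the path vertex \<open>f (i - 1)\<close>. The path has
    \<open>n + 1\<close> vertices, which gives length \<open>n + 2\<close>.\<close>
  define w where "w i = (if i = 0 then v else f (nat (i - 1)))" for i :: int
  have "hole (int n + 2) (\<lambda>i. w (i mod (int n + 2)))"
  proof (rule holeI)
    fix i j :: int assume ij: "0 \<le> i" "i < j" "j < int n + 2"
    show "w i \<noteq> w j" using ij ne[of "nat (i - 1)" "nat (j - 1)"] vne[of "nat (j - 1)"]
      by (auto simp: w_def)
    show "E (w i) (w j) \<longleftrightarrow> j = i + 1 \<or> i = 0 \<and> j = int n + 2 - 1"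
    proof (cases "i = 0")
      case True
      have "nat (j - 1) = 0 \<longleftrightarrow> j = 1" "nat (j - 1) = n \<longleftrightarrow> j = int n + 1" using ij n by auto
      then show ?thesis using True ij vadj[of "nat (j - 1)"] by (auto simp: w_def)
    next
      case False
      have "nat (j - 1) = Suc (nat (i - 1)) \<longleftrightarrow> j = i + 1" using ij False by auto
      then show ?thesis using False ij fadj[of "nat (i - 1)" "nat (j - 1)"] by (auto simp: w_def)
    qed
  qed (use n in auto)
  moreover have "range (\<lambda>i. w (i mod (int n + 2))) \<subseteq> insert v (insert x (insert y W))"
  proof (rule image_subsetI)
    fix i :: int
    define r where "r = i mod (int n + 2)"
    have "r < int n + 2" unfolding r_def by simp
    then have "nat (r - 1) \<le> n" by simp
    then show "w (i mod (int n + 2)) \<in> insert v (insert x (insert y W))"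
      using fin[of "nat (r - 1)"] by (auto simp: w_def r_def[symmetric])
  qed
  ultimately show ?thesis by blast
qed

text \<open>For a component \<open>W\<close> of the non-neighbours of \<open>v\<close>, the set \<open>S\<close> of its attachments is a
  clique, since a shortest path through \<open>W\<close> between nonadjacent attachments closes up through
  \<open>v\<close> to a hole. Induction on \<open>W \<union> S\<close> gives a simplicial vertex inside \<open>W\<close>.\<close>

lemma simplicial_nonneighbour_exists:
  assumes "finite U" "hole_free U"
    and "v \<in> U" "u \<in> U" "u \<noteq> v" "\<not> E v u"
  shows "\<exists>z. simplicial U z \<and> z \<noteq> v \<and> \<not> E v z"
  using assms
proof (induction "card U" arbitrary: U v u rule: less_induct)
  case less
  define M where "M = {z\<in>U. z \<noteq> v \<and> \<not> E v z}"
  define R where "R = {(s, t). E s t \<and> s \<in> M \<and> t \<in> M}"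
  define W where "W = {w. (u, w) \<in> R\<^sup>*}"
  define S where "S = {s\<in>U - W. \<exists>w\<in>W. E s w}"
  have uM: "u \<in> M" using less.prems by (simp add: M_def)
  have WM: "W \<subseteq> M"
  proof
    fix w assume "w \<in> W"
    then have "(u, w) \<in> R\<^sup>*" by (simp add: W_def)
    then show "w \<in> M" by induction (use uM in \<open>auto simp: R_def\<close>)
  qed
  have uW: "u \<in> W" by (simp add: W_def)
  have Wclosed: "t \<in> W" if "s \<in> W" "E s t" "t \<in> M" for s t
  proof -
    have "(u, s) \<in> R\<^sup>*" "(s, t) \<in> R" using that WM by (auto simp: W_def R_def)
    then show ?thesis unfolding W_def by (auto intro: rtrancl_into_rtrancl)
  qed
  \<comment> \<open>A non-neighbour of \<open>v\<close> attached to the component \<open>W\<close>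
    would itself belong to \<open>W\<close>.\<close>
  have Sadj: "E v s" if "s \<in> S" for s
  proof (rule ccontr)
    assume "\<not> E v s"
    moreover obtain w where w: "w \<in> W" "E s w" using \<open>s \<in> S\<close> by (auto simp: S_def)
    moreover have "s \<noteq> v" using w WM by (auto simp: M_def)
    ultimately have "s \<in> M" using that by (auto simp: M_def S_def)
    then show False using Wclosed[of w s] w adj_sym that by (auto simp: S_def)
  qed
  have vS: "v \<notin> S" using Sadj adj_irrefl by auto
  have vW: "v \<notin> W" using WM by (auto simp: M_def)
  have Sclique: "clique S" unfolding clique_def
  proof (intro ballI impI, rule ccontr)
    fix x y assume xy: "x \<in> S" "y \<in> S" "x \<noteq> y" "\<not> E x y"
    obtain a b where ab: "a \<in> W" "E x a" "b \<in> W" "E y b" using xy by (auto simp: S_def)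
    define R' where "R' = {(s, t). E s t \<and> s \<in> insert x (insert y W) \<and> t \<in> insert x (insert y W)}"
    have "(u, w) \<in> R'\<^sup>*" if "w \<in> W" for w
    proof -
      have "(u, w) \<in> R\<^sup>*" using that by (simp add: W_def)
      then show ?thesis
      proof induction
        case (step s t)
        then have "s \<in> W" "t \<in> W" by (auto simp: W_def intro: rtrancl_into_rtrancl)
        then have "(s, t) \<in> R'" using step by (auto simp: R_def R'_def)
        then show ?case using step by (auto intro: rtrancl_into_rtrancl)
      qed simp
    qed
    then have ua: "(u, a) \<in> R'\<^sup>*" and ub: "(u, b) \<in> R'\<^sup>*" using ab by auto
    have "sym R'" using adj_sym by (auto simp: sym_def R'_def)
    then have "(a, u) \<in> R'\<^sup>*" using ua by (metis sym_rtrancl symE)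
    moreover have "(x, a) \<in> R'" "(b, y) \<in> R'" using ab adj_sym by (auto simp: R'_def)
    ultimately have "(x, y) \<in> R'\<^sup>*" using ub
      by (meson converse_rtrancl_into_rtrancl rtrancl_into_rtrancl rtrancl_trans)
    from hole_through_component[OF R'_def this xy(3,4) Sadj[OF xy(1)] Sadj[OF xy(2)] vW]
    obtain k c where "hole k c" "range c \<subseteq> insert v (insert x (insert y W))"
      using WM by (auto simp: M_def)
    moreover have "insert v (insert x (insert y W)) \<subseteq> U"
      using less.prems xy WM by (auto simp: S_def M_def)
    ultimately show False using less.prems(2) unfolding hole_free_def by blast
  qed
  define X where "X = W \<union> S"
  have XU: "X \<subseteq> U" "v \<notin> X" using WM vS vW by (auto simp: X_def S_def M_def)
  have cX: "card X < card U" using XU less.prems by (intro psubset_card_mono) auto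
  have fX: "finite X" using XU less.prems(1) finite_subset by blast
  have hX: "hole_free X" using less.prems(2) XU unfolding hole_free_def by blast
  have "\<exists>z\<in>W. simplicial X z"
  proof (cases "clique X")
    case True
    then have "simplicial X u" using uW by (auto simp: simplicial_def clique_def X_def)
    then show ?thesis using uW by blast
  next
    case False
    show ?thesis
    \<comment> \<open>The induction has to produce a simplicial vertex outside \<open>S\<close>. If
      some \<open>s\<close> in \<open>S\<close> misses a vertex of \<open>X\<close>, a simplicial
      non-neighbour of \<open>s\<close> is outside the clique \<open>S\<close>. Otherwise
      \<open>S\<close> is complete to \<open>X\<close>, and any vertex with a non-neighbour in
      \<open>X\<close> is outside \<open>S\<close>.\<close>
    proof (cases "\<exists>s\<in>S. \<exists>t\<in>X. t \<noteq> s \<and> \<not> E s t")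
      case True
      then obtain s t where st: "s \<in> S" "t \<in> X" "t \<noteq> s" "\<not> E s t" by blast
      then obtain z where z: "simplicial X z" "z \<noteq> s" "\<not> E s z"
        using less.hyps[OF cX fX hX, of s t] by (auto simp: X_def)
      then have "z \<notin> S" using Sclique st by (auto simp: clique_def)
      then show ?thesis using z by (auto simp: simplicial_def X_def)
    next
      case univ: False
      obtain s t where st: "s \<in> X" "t \<in> X" "t \<noteq> s" "\<not> E s t"
        using False by (auto simp: clique_def)
      then obtain z where z: "simplicial X z" "z \<noteq> s" "\<not> E s z"
        using less.hyps[OF cX fX hX, of s t] by auto
      have "z \<notin> S"
      proof
        assume "z \<in> S"
        with univ have "\<forall>t\<in>X. t \<noteq> z \<longrightarrow> E z t" by auto
        then have "E z s" using st(1) z(2) by metis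
        then show False using z(3) adj_sym[of z s] by simp
      qed
      then show ?thesis using z by (auto simp: simplicial_def X_def)
    qed
  qed
  then obtain z where z: "z \<in> W" "simplicial X z" by blast
  \<comment> \<open>All neighbours of \<open>z\<close> lie in \<open>W\<close> or are attachments of
    \<open>W\<close>, so being simplicial in \<open>X\<close> carries over to
    \<open>U\<close>.\<close>
  have "{t\<in>U. E z t} \<subseteq> {t\<in>X. E z t}"
  proof
    fix t assume t: "t \<in> {t\<in>U. E z t}"
    then have "E t z" by (simp add: adj_sym)
    then show "t \<in> {t\<in>X. E z t}" using t z(1) by (auto simp: X_def S_def)
  qed
  then have "simplicial U z" using z XU by (auto simp: simplicial_def clique_def)
  then show ?case using z WM by (auto simp: M_def)
qed

lemma simplicial_exists:
  assumes "finite U" "U \<noteq> {}" "hole_free U"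
  shows "\<exists>z. simplicial U z"
proof (cases "clique U")
  case True
  then show ?thesis using assms(2) by (auto simp: simplicial_def clique_def)
next
  case False
  then obtain v u where "v \<in> U" "u \<in> U" "u \<noteq> v" "\<not> E v u" by (auto simp: clique_def)
  then show ?thesis using simplicial_nonneighbour_exists[OF assms(1,3)] by blast
qed

text \<open>Remove a simplicial vertex \<open>z\<close> with neighbourhood \<open>N\<close>. Either
  \<open>N\<close> is smaller than the clique \<open>Q\<close> of the rest and leaves a colour free
  for \<open>z\<close>, or \<open>z\<close> and \<open>N\<close> form a larger clique that pays for
  a new colour.\<close>

lemma colourable_hole_free:
  assumes "finite U" "hole_free U"
  shows "\<exists>Q\<subseteq>U. clique Q \<and> colourable U (card Q)"
  using assms
proof (induction "card U" arbitrary: U)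
  case 0
  then show ?case by (intro exI[of _ "{}"]) (auto simp: clique_def colourable_def)
next
  case (Suc n)
  then have "U \<noteq> {}" by auto
  then obtain z where z: "simplicial U z" using simplicial_exists Suc.prems by blast
  then have zU: "z \<in> U" by (simp add: simplicial_def)
  have "hole_free (U - {z})" using Suc.prems(2) unfolding hole_free_def by blast
  moreover have "n = card (U - {z})" using Suc.hyps(2) Suc.prems(1) zU by simp
  ultimately have "\<exists>Q\<subseteq>U - {z}. clique Q \<and> colourable (U - {z}) (card Q)"
    using Suc.hyps(1) Suc.prems(1) by blast
  then obtain Q f where Q: "Q \<subseteq> U - {z}" "clique Q"
    and "(\<forall>v\<in>U - {z}. f v < card Q) \<and> (\<forall>u\<in>U - {z}. \<forall>v\<in>U - {z}. E u v \<longrightarrow> f u \<noteq> f v)"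
    unfolding colourable_def by meson
  then have f: "\<And>v. v \<in> U - {z} \<Longrightarrow> f v < card Q"
      "\<And>u v. u \<in> U - {z} \<Longrightarrow> v \<in> U - {z} \<Longrightarrow> E u v \<Longrightarrow> f u \<noteq> f v"
    by blast+
  define N where "N = {u\<in>U. E z u}"
  have N: "clique N" "finite N" "N \<subseteq> U - {z}"
    using z Suc.prems(1) adj_irrefl by (auto simp: simplicial_def N_def)
  have ext: "colourable U m" if "card Q \<le> m" "card N < m" for m
  proof -
    have "\<exists>x<m. x \<notin> f ` N"
    proof (rule ccontr)
      assume "\<not> ?thesis"
      then have "{..<m} \<subseteq> f ` N" by auto
      then have "m \<le> card (f ` N)" using card_mono[of "f ` N" "{..<m}"] N by auto
      then show False using card_image_le[of N f] N that by linarith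
    qed
    then obtain x where x: "x < m" "x \<notin> f ` N" by blast
    show ?thesis unfolding colourable_def
    proof (intro exI[of _ "f(z := x)"] conjI ballI impI)
      fix v assume "v \<in> U"
      then show "(f(z := x)) v < m" using x f(1)[of v] that by auto
    next
      fix s t assume st: "s \<in> U" "t \<in> U" "E s t"
      then show "(f(z := x)) s \<noteq> (f(z := x)) t"
        using f(2)[of s t] x adj_sym[OF st(3)] adj_irrefl by (auto simp: N_def)
    qed
  qed
  show ?case
  proof (cases "card N < card Q")
    case True
    then show ?thesis using ext[of "card Q"] Q by blast
  next
    case False
    have "E z u \<and> E u z" if "u \<in> N" for u using that by (simp add: N_def adj_sym)
    then have "clique (insert z N)" using N(1) by (simp add: clique_def)
    moreover have "card (insert z N) = Suc (card N)" using N by (simp add: subset_Diff_insert)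
    ultimately show ?thesis using ext[of "Suc (card N)"] False zU N(3)
      by (intro exI[of _ "insert z N"]) auto
  qed
qed

section \<open>Neighbourhoods on a shortest hole\<close>

definition shortest_hole :: "'a set \<Rightarrow> int \<Rightarrow> (int \<Rightarrow> 'a) \<Rightarrow> bool" where
  "shortest_hole U k c \<longleftrightarrow> hole k c \<and> range c \<subseteq> U \<and>
     (\<forall>m d. hole m d \<and> range d \<subseteq> U \<longrightarrow> k \<le> m)"

lemma shortest_holeD:
  assumes "shortest_hole U k c"
  shows "hole k c" "range c \<subseteq> U" "\<And>m d. hole m d \<Longrightarrow> range d \<subseteq> U \<Longrightarrow> k \<le> m"
  using assms by (auto simp: shortest_hole_def)

text \<open>The neighbours of \<open>v\<close> on the hole are exactly the \<open>d + 1\<close>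
  consecutive vertices from \<open>c l\<close> to \<open>c (l + d)\<close>. One window of length
  \<open>k\<close> describes them all because \<open>c\<close> has period \<open>k\<close>.\<close>

definition arc :: "(int \<Rightarrow> 'a) \<Rightarrow> int \<Rightarrow> 'a \<Rightarrow> int \<Rightarrow> int \<Rightarrow> bool" where
  "arc c k v l d \<longleftrightarrow> (d = 1 \<or> d = 2) \<and>
     (\<forall>i. l \<le> i \<and> i < l + k \<longrightarrow> (E v (c i) \<longleftrightarrow> i \<le> l + d))"

lemma arc_shift: "hole k c \<Longrightarrow> arc c k v l d \<Longrightarrow> arc c k v (l + k * t) d"
  unfolding arc_def
proof (intro conjI allI impI; elim conjE)
  fix i assume h: "hole k c" and *: "\<forall>i. l \<le> i \<and> i < l + k \<longrightarrow> E v (c i) = (i \<le> l + d)"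
    and i: "l + k * t \<le> i" "i < l + k * t + k"
  have "c (i - k * t) = c i" using hole_periodic[OF h, of "i - k * t" t] by simp
  then show "E v (c i) \<longleftrightarrow> i \<le> l + k * t + d" using *[rule_format, of "i - k * t"] i by auto
qed

text \<open>A gap between successive neighbours \<open>c p\<close> and \<open>c q\<close> of
  \<open>v\<close> closes through \<open>v\<close> to a hole of length \<open>q - p + 2\<close>
  unless it is nearly the whole cycle. As no hole is shorter than \<open>k\<close>, all neighbours
  lie among at most three consecutive vertices.\<close>

lemma arc_exists:
  assumes sh: "shortest_hole U k c" and k: "k \<ge> 5"
    and U: "v \<in> U" and v: "v \<notin> range c"
    and two: "\<And>p. \<exists>i. c i \<noteq> c p \<and> E v (c i)" and nc: "\<not> E v (c j)"
  shows "\<exists>l d. arc c k v l d"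
proof -
  note h = shortest_holeD(1)[OF sh] and cU = shortest_holeD(2)[OF sh] and short = shortest_holeD(3)[OF sh]
  obtain s where "E v (c s)" using two by blast
  then obtain s where s: "E v (c s)" "j \<le> s" "s < j + k" using hole_shift[OF h, of j s] by auto
  obtain p where p: "E v (c p)" "\<not> E v (c (p + 1))"
  proof -
    \<comment> \<open>If each neighbour were followed by another, adjacency would spread from
      \<open>c s\<close> up to \<open>c (j + k)\<close>, which equals the non-neighbour
      \<open>c j\<close>.\<close>
    have "\<exists>p. E v (c p) \<and> \<not> E v (c (p + 1))"
    proof (rule ccontr)
      assume "\<not> ?thesis"
      then have step: "\<And>p. E v (c p) \<Longrightarrow> E v (c (p + 1))" by blast
      have "E v (c (s + int n))" for n
      proof (induction n)
        case (Suc n)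
        then show ?case using step[of "s + int n"] by (simp add: ac_simps)
      qed (use s in simp)
      from this[of "nat (j + k - s)"] have "E v (c (j + k))" using s by simp
      then show False using nc hole_period[OF h] by simp
    qed
    then show ?thesis using that by blast
  qed
  define n where "n = (LEAST n. n > 0 \<and> E v (c (p + int n)))"
  \<comment> \<open>The vertex \<open>c p\<close> recurs after one period, so the next neighbour is
    at distance at most \<open>k\<close>.\<close>
  have k0: "nat k > 0 \<and> E v (c (p + int (nat k)))" using k p(1) hole_period[OF h] by simp
  have n: "n > 0 \<and> E v (c (p + int n))" unfolding n_def by (rule LeastI[of "\<lambda>n. n > 0 \<and> E v (c (p + int n))", OF k0])
  have nk: "int n \<le> k" using Least_le[of "\<lambda>n. n > 0 \<and> E v (c (p + int n))", OF k0] k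
    unfolding n_def by linarith
  have least: "\<not> E v (c i)" if "p < i" "i < p + int n" for i
    using not_less_Least[of "nat (i - p)" "\<lambda>n. n > 0 \<and> E v (c (p + int n))"] that
    unfolding n_def by auto
  define q where "q = p + int n"
  have q: "E v (c q)" "q \<le> p + k" "p < q" using n nk by (auto simp: q_def)
  have none: "\<not> E v (c i)" if "p < i" "i < q" for i using least that by (simp add: q_def)
  have "q \<noteq> p + 1" using q p by auto
  have "q \<ge> p + k - 2"
  proof (rule ccontr)
    assume no: "\<not> ?thesis"
    then have "2 \<le> q - p" "q - p \<le> k - 2" using q \<open>q \<noteq> p + 1\<close> by auto
    from hole_chord[OF h v p(1) q(1) this none] obtain d
      where "hole (q - p + 2) d" "range d \<subseteq> insert v (range c)" by blast
    then show False using short[of "q - p + 2" d] U cU no by auto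
  qed
  moreover have "q \<noteq> p + k"
  proof
    assume qk: "q = p + k"
    obtain i where "c i \<noteq> c p" "E v (c i)" using two by blast
    then obtain i where "c i \<noteq> c p" "E v (c i)" "p \<le> i" "i < p + k"
      using hole_shift[OF h, of p i] by auto
    then show False using none[of i] qk by (cases "i = p") auto
  qed
  ultimately consider "q = p + k - 1" | "q = p + k - 2" using q by linarith
  then show ?thesis
  proof cases
    case 1
    have "arc c k v q 1" unfolding arc_def
    proof (intro conjI allI impI)
      fix i assume i: "q \<le> i \<and> i < q + k"
      have pk: "c (p + k) = c p" "c (i - k) = c i" using hole_period[OF h] by auto
      show "E v (c i) \<longleftrightarrow> i \<le> q + 1"
        using i none[of "i - k"] pk 1 p q
        by (cases "i = q"; cases "i = q + 1") auto
    qed simp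
    then show ?thesis by blast
  next
    case 2
    have pk: "c (p + k) = c p" using hole_period[OF h] by auto
    \<comment> \<open>Otherwise \<open>v\<close> and the three vertices from \<open>c q\<close> to
      \<open>c (q + 2)\<close> would form a hole of length four.\<close>
    have mid: "E v (c (q + 1))"
    proof (rule ccontr)
      assume no: "\<not> ?thesis"
      have "\<not> E v (c i)" if "q < i" "i < p + k" for i
      proof -
        have "i = q + 1" using that 2 by linarith
        then show ?thesis using no by simp
      qed
      moreover have "E v (c (p + k))" using p pk by simp
      ultimately obtain d where "hole (p + k - q + 2) d" "range d \<subseteq> insert v (range c)"
        using hole_chord[OF h v q(1), of "p + k"] 2 k by auto
      then show False using short[of "p + k - q + 2" d] U cU 2 k by auto
    qed
    have "arc c k v q 2" unfolding arc_def
    proof (intro conjI allI impI)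
      fix i assume i: "q \<le> i \<and> i < q + k"
      have pk': "c (i - k) = c i" using hole_period[OF h] by auto
      show "E v (c i) \<longleftrightarrow> i \<le> q + 2"
        using i none[of "i - k"] pk pk' 2 p q mid
        by (cases "i = q"; cases "i = q + 1"; cases "i = q + 2") auto
    qed simp
    then show ?thesis by blast
  qed
qed

text \<open>Two arcs of three vertices cannot share just an end: bypassing the three inner vertices
  of their union by the edge \<open>vw\<close> would give a hole of length \<open>k - 1\<close>.\<close>

lemma arcs_overlap:
  assumes sh: "shortest_hole U k c" and k: "k \<ge> 6"
    and U: "v \<in> U" "w \<in> U" and nc: "v \<notin> range c" "w \<notin> range c" and vw: "E v w"
    and av: "arc c k v l d" and aw: "arc c k w m e" and lm: "l \<le> m" "m \<le> l + d"
  shows "m + e - l \<le> 3"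
proof (rule ccontr)
  note h = shortest_holeD(1)[OF sh] and cU = shortest_holeD(2)[OF sh] and short = shortest_holeD(3)[OF sh]
  assume no: "\<not> ?thesis"
  have de: "d = 1 \<or> d = 2" "e = 1 \<or> e = 2" using av aw by (auto simp: arc_def)
  \<comment> \<open>Each of \<open>m - l\<close> and \<open>e\<close> is at most \<open>2\<close>,
    so a sum of at least \<open>4\<close> forces equality everywhere.\<close>
  then have eq: "m = l + 2" "d = 2" "e = 2" using no lm by auto
  have "E v (c l)" using av k by (auto simp: arc_def)
  then have v1: "E v (c (l + k))" using hole_period[OF h] by simp
  have w1: "E w (c (l + 4))" using aw k eq by (auto simp: arc_def)
  have "\<not> E w (c i)" if "l + 4 < i" "i \<le> l + k" for i
    using aw that eq by (auto simp: arc_def)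
  moreover have "\<not> E v (c i)" if "l + 4 \<le> i" "i < l + k" for i
    using av that eq by (auto simp: arc_def)
  ultimately obtain f where "hole (l + k - (l + 4) + 3) f" "range f \<subseteq> insert w (insert v (range c))"
    using hole_detour[OF h nc(2) w1 nc(1) v1 adj_sym[OF vw]] k by auto
  then show False using short[of "l + k - (l + 4) + 3" f] U cU by auto
qed

text \<open>Arcs of adjacent vertices intersect, and their union spans at most four vertices, after
  moving one of them by a multiple of the period. If they were disjoint, the edge \<open>vw\<close>
  would close up both stretches of the hole between them; the two resulting lengths sum to
  \<open>k + 6 - d - e\<close>, too little for both to reach \<open>k\<close>.\<close>

lemma arcs_meet:
  assumes sh: "shortest_hole U k c" and k: "k \<ge> 6"
    and U: "v \<in> U" "w \<in> U" and nc: "v \<notin> range c" "w \<notin> range c" and vw: "E v w"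
    and av: "arc c k v l d" and aw: "arc c k w m e"
  shows "\<exists>t. m + k * t \<le> l + d \<and> l \<le> m + k * t + e \<and>
    m + k * t + e - l \<le> 3 \<and> l + d - (m + k * t) \<le> 3"
proof -
  note h = shortest_holeD(1)[OF sh] and cU = shortest_holeD(2)[OF sh] and short = shortest_holeD(3)[OF sh]
  have de: "d = 1 \<or> d = 2" "e = 1 \<or> e = 2" using av aw by (auto simp: arc_def)
  \<comment> \<open>This shift moves the start of the second arc into the period that begins at
    \<open>l\<close>.\<close>
  define s where "s = - ((m - l) div k)"
  define n where "n = m + k * s"
  have "n = l + (m - l) mod k" unfolding n_def s_def
    by (simp add: algebra_simps minus_mult_div_eq_mod[symmetric])
  then have n: "l \<le> n" "n < l + k" using k by auto
  have an: "arc c k w n e" unfolding n_def by (rule arc_shift[OF h aw])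
  \<comment> \<open>The second arc starts inside the first, or reaches around the cycle to the next
    copy of the start of the first, or is disjoint from it.\<close>
  consider "n \<le> l + d" | "n > l + d" "n + e \<ge> l + k" | "n > l + d" "n + e < l + k" by linarith
  then show ?thesis
  proof cases
    case 1
    then have "n + e - l \<le> 3" using arcs_overlap[OF sh k U nc vw av an] n by auto
    then show ?thesis using 1 n de unfolding n_def by (intro exI[of _ s]) auto
  next
    case 2
    have "arc c k w (n - k) e" using arc_shift[OF h an, of "-1"] by simp
    then have "l + d - (n - k) \<le> 3"
      using arcs_overlap[OF sh k U(2,1) nc(2,1) adj_sym[OF vw] _ av, where l = "n - k" and d = e] n 2 by auto
    then have "n - k \<le> l + d \<and> l \<le> n - k + e \<and> n - k + e - l \<le> 3 \<and> l + d - (n - k) \<le> 3"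
      using 2 n de by auto
    moreover have "n - k = m + k * (s - 1)" unfolding n_def by (simp add: algebra_simps)
    ultimately show ?thesis by (intro exI[of _ "s - 1"]) simp
  next
    case 3
    have ev: "E v (c i) \<longleftrightarrow> i \<le> l + d" if "l \<le> i" "i < l + k" for i
      using av that by (simp add: arc_def)
    have ew: "E w (c i) \<longleftrightarrow> i \<le> n + e" if "n \<le> i" "i < n + k" for i
      using an that by (simp add: arc_def)
    have v1: "E v (c (l + d))" "E v (c (l + k))" using ev[of "l + d"] ev[of l] de k hole_period[OF h] by auto
    have w1: "E w (c n)" "E w (c (n + e))" using ew[of n] ew[of "n + e"] de k by auto
    have ew': "\<not> E w (c i)" if "n + e - k < i" "i < n" for i
      using ew[of "i + k"] that hole_period(1)[OF h, of i] de by auto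
    have "\<exists>f. hole (n - (l + d) + 3) f \<and> range f \<subseteq> insert v (insert w (range c))"
      using 3 n de by (intro hole_detour[OF h nc(1) v1(1) nc(2) w1(1) vw]) (auto simp: ev ew')
    then have "k \<le> n - (l + d) + 3" using short U cU by fastforce
    moreover have "\<exists>f. hole (l + k - (n + e) + 3) f \<and> range f \<subseteq> insert w (insert v (range c))"
      using 3 n de
      by (intro hole_detour[OF h nc(2) w1(2) nc(1) v1(2) adj_sym[OF vw]]) (auto simp: ev ew)
    then have "k \<le> l + k - (n + e) + 3" using short U cU by fastforce
    ultimately show ?thesis using k de by auto
  qed
qed

text \<open>Vertices complete to the hole impose nothing. The arcs of the others can be lifted to
  pairwise intersecting integer intervals, so the largest left end \<open>p\<close> lies in all of
  them. If every arc has three vertices, two of them span at most four, so left ends differ by at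
  most one and \<open>p + 1\<close> is common as well.\<close>

lemma clique_common_neighbours:
  assumes sh: "shortest_hole U k c" and k: "k \<ge> 6"
    and Q: "clique Q" "finite Q" "Q \<subseteq> U - range c"
    and two: "\<forall>v\<in>Q. \<forall>p. \<exists>i. c i \<noteq> c p \<and> E v (c i)"
  shows "\<exists>p. \<forall>v\<in>Q. E v (c p)"
    and "\<forall>v\<in>Q. \<forall>p. \<exists>i. c i \<noteq> c p \<and> c i \<noteq> c (p + 1) \<and> E v (c i) \<Longrightarrow>
      \<exists>p. \<forall>v\<in>Q. E v (c p) \<and> E v (c (p + 1))"
proof -
  note h = shortest_holeD(1)[OF sh] and cU = shortest_holeD(2)[OF sh] and short = shortest_holeD(3)[OF sh]
  define N where "N = {v\<in>Q. \<exists>j. \<not> E v (c j)}"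
  have "\<exists>l d. arc c k v l d" if "v \<in> N" for v
    using arc_exists[OF sh, of v] that k Q(3) two by (auto simp: N_def)
  then obtain l0 d where l0: "\<And>v. v \<in> N \<Longrightarrow> arc c k v (l0 v) (d v)" by metis
  have d: "d v = 1 \<or> d v = 2" if "v \<in> N" for v using l0[OF that] by (simp add: arc_def)
  have NQ: "N \<subseteq> Q" "finite N" using Q by (auto simp: N_def)
  have res: "\<exists>l. (\<forall>v\<in>N. arc c k v (l v) (d v)) \<and> (\<forall>v\<in>N. \<forall>w\<in>N. l v \<le> l w + d w \<and> l v + d v - l w \<le> 3)"
  proof (cases "N = {}")
    case False
    then obtain v0 where v0: "v0 \<in> N" by blast
    have meet: "\<exists>t. l w + k * t \<le> l v + d v \<and> l v \<le> l w + k * t + d w \<and>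
        l w + k * t + d w - l v \<le> 3 \<and> l v + d v - (l w + k * t) \<le> 3"
      if "v \<in> N" "w \<in> N" "v \<noteq> w" "arc c k v (l v) (d v)" "arc c k w (l w) (d w)" for v w l
    proof -
      have "E v w" using that Q(1) NQ by (auto simp: clique_def)
      have "v \<in> U" "w \<in> U" "v \<notin> range c" "w \<notin> range c" using that NQ Q(3) by blast+
      then show ?thesis using arcs_meet[OF sh k _ _ _ _ \<open>E v w\<close> that(4,5)] by simp
    qed
    have "\<exists>t. l0 w + k * t \<le> l0 v0 + d v0 \<and> l0 v0 \<le> l0 w + k * t + d w \<and>
        l0 w + k * t + d w - l0 v0 \<le> 3 \<and> l0 v0 + d v0 - (l0 w + k * t) \<le> 3" if "w \<in> N" for w
    proof (cases "w = v0")
      case True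
      then show ?thesis using d[OF v0] by (intro exI[of _ 0]) auto
    next
      case False
      then show ?thesis using meet[OF v0 that, of l0] l0 v0 that by auto
    qed
    then obtain t where t: "\<And>w. w \<in> N \<Longrightarrow> l0 w + k * t w \<le> l0 v0 + d v0 \<and>
        l0 v0 \<le> l0 w + k * t w + d w \<and>
        l0 w + k * t w + d w - l0 v0 \<le> 3 \<and> l0 v0 + d v0 - (l0 w + k * t w) \<le> 3" by metis
    define l where "l w = l0 w + k * t w" for w
    have al: "arc c k v (l v) (d v)" if "v \<in> N" for v
      unfolding l_def by (rule arc_shift[OF h l0[OF that]])
    have "l v \<le> l w + d w \<and> l v + d v - l w \<le> 3" if v: "v \<in> N" and w: "w \<in> N" for v w
    proof (cases "v = w")
      case True
      then show ?thesis using d[OF w] by auto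
    next
      case False
      then obtain s where s: "l w + k * s \<le> l v + d v" "l v \<le> l w + k * s + d w"
        "l v + d v - (l w + k * s) \<le> 3"
        using meet[OF v w False al[OF v] al[OF w]] by blast
      have win: "l w \<ge> l0 v0 - 2" "l w + d w \<le> l0 v0 + 3" "l v \<ge> l0 v0 - 2" "l v + d v \<le> l0 v0 + 3"
        using t[OF v] t[OF w] d[OF v0] by (auto simp: l_def)
      \<comment> \<open>All lifted arcs lie within six consecutive integers around the arc of
        \<open>v0\<close>, so a shift by a nonzero multiple of \<open>k \<ge> 6\<close> would
        prevent them from meeting.\<close>
      have "s = 0"
      proof (rule ccontr)
        assume "s \<noteq> 0"
        then consider "s \<ge> 1" | "s \<le> -1" by linarith
        then show False
        proof cases
          case 1
          then have "k * s \<ge> k * 1" using k by (intro mult_left_mono) auto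
          then show False using s win k by linarith
        next
          case 2
          then have "k * s \<le> k * (-1)" using k by (intro mult_left_mono) auto
          then show False using s win k by linarith
        qed
      qed
      then show ?thesis using s by simp
    qed
    then show ?thesis using al by blast
  qed auto
  then obtain l where l: "\<And>v. v \<in> N \<Longrightarrow> arc c k v (l v) (d v)"
    and lw: "\<And>v w. v \<in> N \<Longrightarrow> w \<in> N \<Longrightarrow> l v \<le> l w + d w \<and> l v + d v - l w \<le> 3" by blast
  define p where "p = Max (l ` N)"
  have p: "l v \<le> p" "p \<le> l v + d v" if "v \<in> N" for v
  proof -
    show "l v \<le> p" unfolding p_def using that NQ by auto
    have "p \<in> l ` N" unfolding p_def using that NQ by (intro Max_in) auto
    then show "p \<le> l v + d v" using lw that by auto
  qed
  have *: "E v (c i)" if "v \<in> N" "l v \<le> i" "i \<le> l v + d v" for v i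
    using l[OF that(1)] that d[OF that(1)] k by (auto simp: arc_def)
  have "E v (c p)" if "v \<in> Q" for v
    using *[of v p] p that by (cases "v \<in> N") (auto simp: N_def)
  then show "\<exists>p. \<forall>v\<in>Q. E v (c p)" by blast
  assume three: "\<forall>v\<in>Q. \<forall>p. \<exists>i. c i \<noteq> c p \<and> c i \<noteq> c (p + 1) \<and> E v (c i)"
  \<comment> \<open>An arc of two vertices leaves no neighbour off the consecutive pair
    \<open>c (l v)\<close> and \<open>c (l v + 1)\<close>.\<close>
  have d2: "d v = 2" if vN: "v \<in> N" for v
  proof (rule ccontr)
    assume "d v \<noteq> 2"
    then have dv: "d v = 1" using d vN by blast
    obtain i where "c i \<noteq> c (l v)" "c i \<noteq> c (l v + 1)" "E v (c i)"
      using three vN NQ by blast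
    then obtain i where i: "c i \<noteq> c (l v)" "c i \<noteq> c (l v + 1)" "E v (c i)" "l v \<le> i" "i < l v + k"
      using hole_shift[OF h, of "l v" i] by auto
    then have "i \<le> l v + 1" using l[OF vN] dv by (auto simp: arc_def)
    then have "i = l v \<or> i = l v + 1" using i(4) by linarith
    then show False using i by auto
  qed
  have "p + 1 \<le> l v + d v" if "v \<in> N" for v
  proof -
    have "p \<in> l ` N" unfolding p_def using that NQ by (intro Max_in) auto
    then obtain u where "u \<in> N" "p = l u" by auto
    then show ?thesis using lw[of u v] that d2 by auto
  qed
  then have "E v (c (p + 1))" if "v \<in> Q" for v
    using *[of v "p + 1"] p(1)[of v] that by (cases "v \<in> N") (auto simp: N_def)
  then show "\<exists>p. \<forall>v\<in>Q. E v (c p) \<and> E v (c (p + 1))"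
    using \<open>\<And>v. v \<in> Q \<Longrightarrow> E v (c p)\<close> by blast
qed

section \<open>Packing connected dominating sets\<close>

lemma colourable_add_stable:
  assumes "colourable (U - S) n" "stable S"
  shows "colourable U (Suc n)"
proof -
  obtain f where f: "\<forall>v\<in>U - S. f v < n" "\<forall>u\<in>U - S. \<forall>v\<in>U - S. E u v \<longrightarrow> f u \<noteq> f v"
    using assms(1) unfolding colourable_def by meson
  show ?thesis unfolding colourable_def
  proof (intro exI[of _ "\<lambda>v. if v \<in> S then n else f v"] conjI ballI impI)
    fix v assume "v \<in> U"
    then show "(if v \<in> S then n else f v) < Suc n" using f(1) by (simp add: less_SucI)
  next
    fix u v assume uv: "u \<in> U" "v \<in> U" "E u v"
    then have "\<not> (u \<in> S \<and> v \<in> S)" using assms(2) by (auto simp: stable_def)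
    moreover have "f w \<noteq> n" if "w \<in> U - S" for w using f(1) that by auto
    ultimately show "(if u \<in> S then n else f u) \<noteq> (if v \<in> S then n else f v)"
      using f(2) uv by auto
  qed
qed

text \<open>In the window from \<open>1\<close> to \<open>k\<close>, \<open>S 0\<close> takes the
  odd and \<open>S 1\<close> the even indices up to \<open>2 * n\<close>. For odd \<open>k\<close>
  the index \<open>k\<close> is left over, and it names the vertex \<open>c 0\<close>.\<close>

lemma hole_alternate_cover:
  assumes h: "hole k c" and k: "k = 2 * int n \<or> k = 2 * int n + 1"
  defines "S p \<equiv> (\<lambda>j. c (p + 1 + 2 * int j)) ` {..<n}"
  shows "range c = S 0 \<union> S 1 \<union> (if k = 2 * int n then {} else {c 0})"
proof (intro equalityI subsetI)
  fix v assume "v \<in> range c"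
  then obtain i0 where "v = c i0" by blast
  then obtain i where i: "v = c i" "1 \<le> i" "i < 1 + k" using hole_shift[OF h, of 1 i0] by auto
  consider "i > 2 * int n" | "i \<le> 2 * int n" "odd i" | "i \<le> 2 * int n" "even i" by linarith
  then show "v \<in> S 0 \<union> S 1 \<union> (if k = 2 * int n then {} else {c 0})"
  proof cases
    case 1
    then have "k \<noteq> 2 * int n" "i = 0 + k" using i k by auto
    then show ?thesis using i hole_period(1)[OF h, of 0] by simp
  next
    case 2
    then obtain j where j: "i = 2 * j + 1" by (auto elim: oddE)
    have "v = c (0 + 1 + 2 * int (nat j))" "nat j < n" using 2 i j by (auto simp: add.commute)
    then show ?thesis unfolding S_def by blast
  next
    case 3
    then obtain j where j: "i = 2 * j" by (auto elim: evenE)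
    have "v = c (1 + 1 + 2 * int (nat (j - 1)))" "nat (j - 1) < n"
      using 3 i j by (auto simp: algebra_simps)
    then show ?thesis unfolding S_def by blast
  qed
qed (auto simp: S_def split: if_splits)

text \<open>The hole splits into two stable sets, plus a single vertex if its length is odd, and
  each of these gets a fresh colour.\<close>

lemma colourable_add_hole:
  assumes h: "hole k c" and n: "colourable (U - range c) n"
  shows "k = 2 * int m \<Longrightarrow> colourable U (n + 2)"
    and "k = 2 * int m + 1 \<Longrightarrow> colourable U (n + 3)"
proof -
  define S where "S p = (\<lambda>j. c (p + 1 + 2 * int j)) ` {..<m}" for p
  have st: "stable (S 0)" "stable (S 1)" if "2 * int m \<le> k"
    unfolding S_def using stable_alternate(1)[OF h that] by blast+
  show "colourable U (n + 2)" if k: "k = 2 * int m"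
  proof -
    have "range c = S 0 \<union> S 1" using hole_alternate_cover[OF h, of m] k by (simp add: S_def)
    then have "U - range c = U - S 0 - S 1" by blast
    then have "colourable (U - S 0 - S 1) n" using n by simp
    then have "colourable U (Suc (Suc n))" using st k by (blast intro: colourable_add_stable)
    then show ?thesis by simp
  qed
  show "colourable U (n + 3)" if k: "k = 2 * int m + 1"
  proof -
    have "range c = S 0 \<union> S 1 \<union> {c 0}"
      using hole_alternate_cover[OF h, of m] k by (simp add: S_def)
    then have "U - range c = U - S 0 - S 1 - {c 0}" by blast
    then have "colourable (U - S 0 - S 1 - {c 0}) n" using n by simp
    moreover have "stable {c 0}" using adj_irrefl by (simp add: stable_def)
    ultimately have "colourable (U - S 0 - S 1) (Suc n)" by (rule colourable_add_stable)
    then have "colourable (U - S 0) (Suc (Suc n))" 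
      by (rule colourable_add_stable) (use st k in auto)
    then have "colourable U (Suc (Suc (Suc n)))" 
      by (rule colourable_add_stable) (use st k in auto)
    then show ?thesis by (simp add: numeral_3_eq_3)
  qed
qed

text \<open>If no edge crosses a cut, walking along the segment from \<open>c s\<close> never leaves
  the side of \<open>c s\<close>.\<close>

lemma connected_hole_segment:
  assumes h: "hole k c" and "s \<le> t"
  shows "connected_set E (c ` {s..t})"
proof -
  have *: "\<exists>a\<in>A. \<exists>b\<in>B. E a b"
    if AB: "A \<union> B = c ` {s..t}" "A \<inter> B = {}" "B \<noteq> {}" "c s \<in> A" for A B
  proof (rule ccontr)
    assume no: "\<not> ?thesis"
    have "s + int n \<le> t \<longrightarrow> c (s + int n) \<in> A" for n
    proof (induction n)
      case (Suc n)
      show ?case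
      proof
        assume le: "s + int (Suc n) \<le> t"
        then have A: "c (s + int n) \<in> A" using Suc by simp
        have "c (s + int (Suc n)) \<in> A \<union> B" unfolding AB(1) using le by auto
        moreover have "E (c (s + int n)) (c (s + int (Suc n)))"
          using hole_next(1)[OF h, of "s + int n"] by (simp add: ac_simps)
        ultimately show "c (s + int (Suc n)) \<in> A" using no A by blast
      qed
    qed (use AB in simp)
    then have "c i \<in> A" if "s \<le> i" "i \<le> t" for i
      using that by (metis nat_0_le add_diff_cancel_left' diff_ge_0_iff_ge le_add_diff_inverse)
    then have "c ` {s..t} \<subseteq> A" by auto
    then show False using AB by blast
  qed
  have "\<exists>a\<in>A. \<exists>b\<in>B. E a b"
    if AB: "A \<union> B = c ` {s..t}" "A \<inter> B = {}" "A \<noteq> {}" "B \<noteq> {}" for A B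
  proof (cases "c s \<in> A")
    case True
    then show ?thesis using * AB by blast
  next
    case False
    have "c s \<in> A \<union> B" unfolding AB(1) using assms(2) by auto
    then have "c s \<in> B" using False by blast
    then have "\<exists>b\<in>B. \<exists>a\<in>A. E b a" using *[of B A] AB by (simp add: Un_commute Int_commute)
    then show ?thesis using adj_sym by metis
  qed
  then show ?thesis using assms(2) unfolding connected_set_def by auto
qed

end

section \<open>Graphs whose stable sets have at most a vertices and whose holes have length at least
  2a\<close>

locale long_hole_graph = adjacency E for E :: "'a \<Rightarrow> 'a \<Rightarrow> bool" +
  fixes V :: "'a set" and a :: nat
  assumes finite_V: "finite V" and a: "a \<ge> 3"
    and stable_le: "S \<subseteq> V \<Longrightarrow> stable S \<Longrightarrow> card S \<le> a"
    and hole_ge: "hole k c \<Longrightarrow> range c \<subseteq> V \<Longrightarrow> 2 * int a \<le> k"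
begin

text \<open>A longer hole would contain \<open>a + 1\<close> pairwise nonadjacent alternate
  vertices.\<close>

lemma hole_length:
  assumes "hole k c" "range c \<subseteq> V"
  shows "k = 2 * int a \<or> k = 2 * int a + 1"
proof (rule ccontr)
  assume "\<not> ?thesis"
  then have "2 * int (Suc a) \<le> k" using hole_ge[OF assms] by auto
  from stable_alternate[OF assms(1) this, of 0] stable_le
  show False using assms(2) by (metis (no_types, lifting) Suc_n_not_le_n image_subsetI rangeI subset_iff)
qed

text \<open>The \<open>a\<close> alternate vertices already form a stable set of maximum size, so
  \<open>v\<close> cannot be added to it.\<close>

lemma alternate_neighbour:
  assumes h: "hole k c" "range c \<subseteq> V" and v: "v \<in> V" "v \<notin> range c"
  shows "\<exists>j<a. E v (c (p + 1 + 2 * int j))"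
proof (rule ccontr)
  assume no: "\<not> ?thesis"
  define S where "S = (\<lambda>j. c (p + 1 + 2 * int j)) ` {..<a}"
  have S: "stable S" "card S = a"
    unfolding S_def using stable_alternate[OF h(1) hole_ge[OF h]] by blast+
  have nS: "\<not> E v s \<and> \<not> E s v" if "s \<in> S" for s
    using no that adj_sym[of s v] by (auto simp: S_def)
  have "stable (insert v S)" using S(1) nS adj_irrefl by (auto simp: stable_def)
  moreover have "insert v S \<subseteq> V" using h(2) v by (auto simp: S_def)
  moreover have "v \<notin> S" "finite S" using v by (auto simp: S_def)
  ultimately show False using stable_le[of "insert v S"] S(2) by simp
qed

text \<open>The alternate vertices from \<open>c (p + 1)\<close> to \<open>c (p + 2 * a - 1)\<close>
  avoid \<open>c p\<close>.\<close>

lemma neighbour_off_one: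
  assumes h: "hole k c" "range c \<subseteq> V" and v: "v \<in> V" "v \<notin> range c"
  shows "\<exists>i. c i \<noteq> c p \<and> E v (c i)"
proof -
  obtain j where j: "j < a" "E v (c (p + 1 + 2 * int j))" using alternate_neighbour[OF assms] by blast
  moreover have "c (p + 1 + 2 * int j) \<noteq> c p"
    using hole_eq_iff[OF h(1), of "p + 1 + 2 * int j" p] hole_ge[OF h] j by auto
  ultimately show ?thesis by blast
qed

text \<open>With one more vertex on the hole, the alternate set can start at \<open>p + 2\<close>.
  It ends at \<open>p + 2 * a = p + k - 1\<close>, just before \<open>c p\<close> recurs.\<close>

lemma neighbour_off_two:
  assumes h: "hole k c" "range c \<subseteq> V" and v: "v \<in> V" "v \<notin> range c" and k: "k = 2 * int a + 1"
  shows "\<exists>i. c i \<noteq> c p \<and> c i \<noteq> c (p + 1) \<and> E v (c i)"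
proof -
  obtain j where j: "j < a" "E v (c (p + 1 + 1 + 2 * int j))"
    using alternate_neighbour[OF assms(1-4), of "p + 1"] by blast
  moreover have "c (p + 1 + 1 + 2 * int j) \<noteq> c p" "c (p + 1 + 1 + 2 * int j) \<noteq> c (p + 1)"
    using hole_eq_iff[OF h(1), of "p + 1 + 1 + 2 * int j" p]
      hole_eq_iff[OF h(1), of "p + 1 + 1 + 2 * int j" "p + 1"] k j by auto
  ultimately show ?thesis by blast
qed

text \<open>A vertex off the hole has a neighbour other than the removed vertices, and each removed
  vertex is adjacent to an end of the remaining path.\<close>

lemma hole_path_dominates:
  assumes h: "hole k c" "range c \<subseteq> V"
  shows "dominates (c ` {p + 1..p + k - 1}) V"
    and "k = 2 * int a + 1 \<Longrightarrow> dominates (c ` {p + 2..p + k - 1}) V"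
proof -
  have k: "k \<ge> 6" using hole_ge[OF h] a by simp
  have mem: "\<exists>j. v = c j \<and> p \<le> j \<and> j < p + k" if "v \<in> range c" for v
    using that hole_shift[OF h(1), of p] by auto
  show "dominates (c ` {p + 1..p + k - 1}) V"
    unfolding dominates_def
  proof
    fix v assume v: "v \<in> V - c ` {p + 1..p + k - 1}"
    show "\<exists>r\<in>c ` {p + 1..p + k - 1}. E v r"
    proof (cases "v \<in> range c")
      case True
      then obtain j where j: "v = c j" "p \<le> j" "j < p + k" using mem by blast
      moreover have "\<not> p + 1 \<le> j" using v j by auto
      ultimately have "v = c p" by (cases "j = p") auto
      then show ?thesis using hole_next(1)[OF h(1), of p] k by auto
    next
      case False
      then obtain i where i: "c i \<noteq> c p" "E v (c i)" using neighbour_off_one[OF h] v by blast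
      obtain j where j: "c i = c j" "p \<le> j" "j < p + k" using mem[of "c i"] by auto
      then have "j \<noteq> p" using i by auto
      then have "j \<in> {p + 1..p + k - 1}" using j by auto
      then show ?thesis using i j by auto
    qed
  qed
  show "dominates (c ` {p + 2..p + k - 1}) V" if ka: "k = 2 * int a + 1"
    unfolding dominates_def
  proof
    fix v assume v: "v \<in> V - c ` {p + 2..p + k - 1}"
    show "\<exists>r\<in>c ` {p + 2..p + k - 1}. E v r"
    proof (cases "v \<in> range c")
      case True
      then obtain j where j: "v = c j" "p \<le> j" "j < p + k" using mem by blast
      moreover have "\<not> p + 2 \<le> j" using v j by auto
      ultimately have "j = p \<or> j = p + 1" by auto
      then show ?thesis
      proof
        assume "j = p"
        have "E (c (p + k - 1)) (c (p + k))" using hole_next(1)[OF h(1), of "p + k - 1"] by simp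
        then have "E (c p) (c (p + k - 1))" using hole_period(1)[OF h(1), of p] adj_sym by simp
        then show ?thesis using j \<open>j = p\<close> k by auto
      next
        assume "j = p + 1"
        then show ?thesis using j hole_next(1)[OF h(1), of "p + 1"] k by auto
      qed
    next
      case False
      then obtain i where i: "c i \<noteq> c p" "c i \<noteq> c (p + 1)" "E v (c i)"
        using neighbour_off_two[OF h _ _ ka] v by blast
      obtain j where j: "c i = c j" "p \<le> j" "j < p + k" using mem[of "c i"] by auto
      then have "j \<noteq> p" "j \<noteq> p + 1" using i by auto
      then have "j \<in> {p + 2..p + k - 1}" using j by auto
      then show ?thesis using i j by auto
    qed
  qed
qed

text \<open>The sets lie in \<open>U\<close> but dominate all of \<open>V\<close>. Thus they remain
  dominating when \<open>U\<close> grows in the induction.\<close>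

definition clique_packing :: "'a set \<Rightarrow> 'a set \<Rightarrow> 'a set set \<Rightarrow> bool" where
  "clique_packing U Q \<R> \<longleftrightarrow> Q \<subseteq> U \<and> clique Q \<and> finite \<R> \<and>
     (\<forall>R\<in>\<R>. R \<subseteq> U - Q \<and> connected_set E R \<and> dominates R V) \<and>
     (\<forall>R\<in>\<R>. \<forall>R'\<in>\<R>. R \<noteq> R' \<longrightarrow> R \<inter> R' = {})"

text \<open>Puts a deleted hole \<open>C\<close> back: its part \<open>X\<close>, complete to
  \<open>Q\<close>, enlarges the clique, and \<open>R\<close>, taken from the rest of
  \<open>C\<close>, joins the family. The cardinalities add up because the old packing avoids
  \<open>C\<close>.\<close>

lemma clique_packing_add:
  assumes p: "clique_packing (U - C) Q \<R>" and U: "C \<subseteq> U"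
    and X: "X \<subseteq> C" "clique X" "finite X" "\<And>x q. x \<in> X \<Longrightarrow> q \<in> Q \<Longrightarrow> E q x"
    and R: "R \<subseteq> C - X" "connected_set E R" "dominates R V" and Q: "finite Q"
  shows "clique_packing U (Q \<union> X) (insert R \<R>)"
    "card (Q \<union> X) = card Q + card X" "card (insert R \<R>) = card \<R> + 1"
proof -
  have pQ: "Q \<subseteq> U - C" "clique Q" "finite \<R>"
    using p by (auto simp: clique_packing_def)
  have pR: "R' \<subseteq> U - C - Q" "connected_set E R'" "dominates R' V" if "R' \<in> \<R>" for R'
    using p that by (auto simp: clique_packing_def)
  have pd: "\<forall>R\<in>\<R>. \<forall>R'\<in>\<R>. R \<noteq> R' \<longrightarrow> R \<inter> R' = {}"
    using p by (simp add: clique_packing_def)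
  have "R \<noteq> {}" using R(2) by (simp add: connected_set_def)
  have disj: "R \<inter> R' = {}" "R' \<inter> R = {}" if "R' \<in> \<R>" for R' using pR(1)[OF that] R(1) by auto
  then have "R \<notin> \<R>" using \<open>R \<noteq> {}\<close> by blast
  then show "card (insert R \<R>) = card \<R> + 1" using pQ by simp
  show "card (Q \<union> X) = card Q + card X" using pQ X Q by (intro card_Un_disjoint) auto
  have "clique (Q \<union> X)"
    unfolding clique_def
  proof (intro ballI impI)
    fix u v assume "u \<in> Q \<union> X" "v \<in> Q \<union> X" "u \<noteq> v"
    then show "E u v" using pQ(2) X(2) X(4)[of u v] X(4)[of v u] adj_sym[of v u]
      by (auto simp: clique_def)
  qed
  moreover have "Q \<union> X \<subseteq> U" using pQ(1) X(1) U by auto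
  moreover have "R' \<subseteq> U - (Q \<union> X)" if "R' \<in> insert R \<R>" for R'
  proof (cases "R' = R")
    case True
    then show ?thesis using R(1) U pQ(1) by auto
  next
    case False
    then show ?thesis using pR(1)[of R'] that X(1) by auto
  qed
  ultimately show "clique_packing U (Q \<union> X) (insert R \<R>)"
    using pQ(3) pR(2,3) R(2,3) pd disj by (simp add: clique_packing_def)
qed

text \<open>Strong induction on \<open>card U\<close>. A hole-free set is settled by a clique alone;
  otherwise a shortest hole of \<open>U\<close> is deleted, and what it contributes to the packing
  equals the number of colours spent on it.\<close>

lemma clique_packing_exists:
  assumes "U \<subseteq> V"
  shows "\<exists>Q \<R>. clique_packing U Q \<R> \<and> colourable U (card Q + card \<R>)"
  using assms
proof (induction "card U" arbitrary: U rule: less_induct)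
  case less
  have fU: "finite U" using less.prems finite_V finite_subset by blast
  show ?case
  proof (cases "hole_free U")
    case True
    then obtain Q where "Q \<subseteq> U" "clique Q" "colourable U (card Q)"
      using colourable_hole_free[OF fU] by blast
    then have "clique_packing U Q {}" "colourable U (card Q + card {})"
      by (auto simp: clique_packing_def)
    then show ?thesis by blast
  next
    case False
    define H where "H = (\<lambda>(k, c). hole k c \<and> range c \<subseteq> U)"
    obtain x0 where "H x0" using False by (auto simp: hole_free_def H_def)
    then obtain x where x: "H x" "\<And>y. H y \<Longrightarrow> nat (fst x) \<le> nat (fst y)"
      using ex_has_least_nat[of H x0 "\<lambda>x. nat (fst x)"] by blast
    obtain k c where kc: "x = (k, c)" by force
    have h: "hole k c" and cU: "range c \<subseteq> U" using x(1) by (auto simp: H_def kc)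
    have cV: "range c \<subseteq> V" using cU less.prems by blast
    have short: "k \<le> m" if "hole m d" "range d \<subseteq> U" for m d
    proof -
      have "nat k \<le> nat m" using x(2)[of "(m, d)"] that by (auto simp: H_def kc)
      then show ?thesis using that(1) by (auto simp: hole_def)
    qed
    have k6: "k \<ge> 6" using hole_ge[OF h cV] a by simp
    have "card (U - range c) < card U"
      using fU cU by (intro psubset_card_mono) auto
    then obtain Q \<R> where pk: "clique_packing (U - range c) Q \<R>"
      and col: "colourable (U - range c) (card Q + card \<R>)"
      using less.hyps[of "U - range c"] less.prems by blast
    have Q: "clique Q" "Q \<subseteq> U - range c" "finite Q"
      using pk fU by (auto simp: clique_packing_def intro: finite_subset)
    have QV: "v \<in> V \<and> v \<notin> range c" if "v \<in> Q" for v using that Q(2) less.prems by blast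
    have sh: "shortest_hole U k c" using h cU short by (auto simp: shortest_hole_def)
    have two: "\<forall>v\<in>Q. \<forall>p. \<exists>i. c i \<noteq> c p \<and> E v (c i)"
      using neighbour_off_one[OF h cV] QV by blast
    from hole_length[OF h cV] show ?thesis
    proof
      \<comment> \<open>An even hole costs two colours and provides one clique vertex and one
        dominating path.\<close>
      assume k: "k = 2 * int a"
      obtain p where p: "\<forall>v\<in>Q. E v (c p)"
        using clique_common_neighbours(1)[OF sh k6 Q(1,3,2) two] by blast
      define R where "R = c ` {p + 1..p + k - 1}"
      have R: "R \<subseteq> range c - {c p}"
      proof -
        have "c i \<noteq> c p" if "i \<in> {p + 1..p + k - 1}" for i
          using hole_eq_iff[OF h, of i p] that by auto
        then show ?thesis by (auto simp: R_def)
      qed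
      have "connected_set E R" "dominates R V"
        unfolding R_def using connected_hole_segment[OF h] hole_path_dominates(1)[OF h cV] k6 by auto
      moreover have "E q x" if "x \<in> {c p}" "q \<in> Q" for x q using that p by blast
      moreover have "clique {c p}" by (simp add: clique_def)
      ultimately have "clique_packing U (Q \<union> {c p}) (insert R \<R>)"
        "card (Q \<union> {c p}) = card Q + card {c p}" "card (insert R \<R>) = card \<R> + 1"
        using R Q(3) by (intro clique_packing_add[OF pk cU]; blast)+
      then have "clique_packing U (Q \<union> {c p}) (insert R \<R>)"
        "card (Q \<union> {c p}) + card (insert R \<R>) = card Q + card \<R> + 2"
        by simp_all
      moreover have "colourable U (card Q + card \<R> + 2)"
        by (rule colourable_add_hole(1)[OF h col k])
      ultimately show ?thesis by metis
    next
      \<comment> \<open>An odd hole costs three colours and provides two adjacent clique vertices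
        and one dominating path.\<close>
      assume k: "k = 2 * int a + 1"
      have three: "\<forall>v\<in>Q. \<forall>p. \<exists>i. c i \<noteq> c p \<and> c i \<noteq> c (p + 1) \<and> E v (c i)"
        using neighbour_off_two[OF h cV _ _ k] QV by blast
      obtain p where p: "\<forall>v\<in>Q. E v (c p) \<and> E v (c (p + 1))"
        using clique_common_neighbours(2)[OF sh k6 Q(1,3,2) two three] by blast
      define R where "R = c ` {p + 2..p + k - 1}"
      have R: "R \<subseteq> range c - {c p, c (p + 1)}"
      proof -
        have "c i \<noteq> c p \<and> c i \<noteq> c (p + 1)" if "i \<in> {p + 2..p + k - 1}" for i
          using hole_eq_iff[OF h, of i p] hole_eq_iff[OF h, of i "p + 1"] that by auto
        then show ?thesis by (auto simp: R_def)
      qed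
      have cc: "c p \<noteq> c (p + 1)" using hole_eq_iff[OF h, of p "p + 1"] k6 by simp
      have "clique {c p, c (p + 1)}" using hole_next[OF h, of p] by (simp add: clique_def)
      moreover have "connected_set E R" "dominates R V"
        unfolding R_def using connected_hole_segment[OF h] hole_path_dominates(2)[OF h cV k] k6 by auto
      moreover have "E q x" if "x \<in> {c p, c (p + 1)}" "q \<in> Q" for x q using that p by blast
      ultimately have "clique_packing U (Q \<union> {c p, c (p + 1)}) (insert R \<R>)"
        "card (Q \<union> {c p, c (p + 1)}) = card Q + card {c p, c (p + 1)}"
        "card (insert R \<R>) = card \<R> + 1"
        using R Q(3) by (intro clique_packing_add[OF pk cU]; blast)+
      then have "clique_packing U (Q \<union> {c p, c (p + 1)}) (insert R \<R>)"
        "card (Q \<union> {c p, c (p + 1)}) + card (insert R \<R>) = card Q + card \<R> + 3"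
        using cc by simp_all
      moreover have "colourable U (card Q + card \<R> + 3)"
        by (rule colourable_add_hole(2)[OF h col k])
      ultimately show ?thesis by metis
    qed
  qed
qed

end

section \<open>Return to graphs: induced cycles, complete minors and the chromatic number\<close>

lemma hole_induced_cycle:
  assumes G: "pair_graph G" and A: "adjacency (\<lambda>u v. (u, v) \<in> parcs G)"
    and h: "adjacency.hole (\<lambda>u v. (u, v) \<in> parcs G) k c" and V: "range c \<subseteq> pverts G"
  shows "\<exists>H. induced_subgraph (with_proj H) (with_proj G) \<and>
    digraph_iso (with_proj H) (with_proj (cycle_graph (nat k)))"
proof -
  interpret G: pair_graph G by (rule G)
  interpret A: adjacency "\<lambda>u v. (u, v) \<in> parcs G" by (rule A)
  have k: "k \<ge> 4" using h by (simp add: A.hole_def)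
  define n where "n = nat k"
  have n: "n \<ge> 4" "k = int n" using k by (auto simp: n_def)
  define H where "H = \<lparr>pverts = range c, parcs = parcs G \<inter> range c \<times> range c\<rparr>"
  have H: "pair_graph H"
    by (rule pair_graphI) (auto simp: H_def A.hole_finite[OF h] G.arcs_symmetric dest: G.no_loops')
  then interpret H: pair_graph H .
  have ind: "induced_subgraph (with_proj H) (with_proj G)"
    using G.wf_digraph H.wf_digraph V
    by (simp add: induced_subgraph_def subgraph_def compatible_def) (auto simp: H_def)
  define g where "g i = c (int i)" for i
  have bij: "bij_betw g {..<n} (range c)"
  proof (rule bij_betw_imageI)
    show "inj_on g {..<n}"
    proof (rule inj_onI)
      fix i j assume "i \<in> {..<n}" "j \<in> {..<n}" "g i = g j"
      then show "i = j" using A.hole_eq_iff[OF h, of "int i" "int j"] n by (auto simp: g_def)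
    qed
    have "c ` {0..<k} = g ` {..<n}"
    proof -
      have "{0..<k} = int ` {..<n}" unfolding n(2) by (auto simp: image_int_atLeastLessThan lessThan_atLeast0)
      then show ?thesis by (simp add: g_def image_image)
    qed
    then show "g ` {..<n} = range c" using A.hole_range[OF h, of 0] by simp
  qed
  have adj: "(g i, g j) \<in> parcs H \<longleftrightarrow> (i, j) \<in> parcs (cycle_graph n)" if "i < n" "j < n" for i j
  proof -
    have "(g i, g j) \<in> parcs H \<longleftrightarrow> (c (int i), c (int j)) \<in> parcs G"
      by (simp add: H_def g_def)
    also have "\<dots> \<longleftrightarrow> \<bar>int i - int j\<bar> = 1 \<or> \<bar>int i - int j\<bar> = int n - 1"
      using A.hole_adj_iff[OF h, of "int i" "int j"] that n by auto
    also have "\<dots> \<longleftrightarrow> j = Suc i mod n \<or> i = Suc j mod n"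
      using that n by (auto simp: mod_Suc)
    finally show ?thesis using that by (simp add: cycle_graph_def)
  qed
  define f where "f = inv_into {..<n} g"
  have f: "bij_betw f (range c) {..<n}" unfolding f_def by (rule bij_betw_inv_into[OF bij])
  have "digraph_iso (with_proj H) (with_proj (cycle_graph n))"
  proof (subst digraph_iso_pair_iff[OF H pair_graph_cycle_graph])
    have "(u, v) \<in> parcs H \<longleftrightarrow> (f u, f v) \<in> parcs (cycle_graph n)"
      if "u \<in> range c" "v \<in> range c" for u v
    proof -
      have "f u < n" "f v < n" using bij_betwE[OF f] that by blast+
      moreover have "g (f u) = u" "g (f v) = v"
        unfolding f_def using bij_betw_inv_into_right[OF bij] that by blast+
      ultimately show ?thesis using adj[of "f u" "f v"] by simp
    qed
    then show "\<exists>f. bij_betw f (pverts H) (pverts (cycle_graph n)) \<and>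
      (\<forall>u\<in>pverts H. \<forall>v\<in>pverts H. ((u, v) \<in> parcs H) = ((f u, f v) \<in> parcs (cycle_graph n)))"
      using f by (intro exI[of _ f]) (auto simp: H_def cycle_graph_def)
  qed (use n in simp)
  then show ?thesis using ind unfolding n_def by blast
qed

theorem theorem2p3:
  fixes G :: "'a pair_pre_digraph"
  assumes "pair_graph G"
    and "independence_number G \<ge> 3"
    and "\<forall>k. 4 \<le> k \<and> k \<le> 2 * independence_number G - 1 \<longrightarrow>
      \<not> (\<exists>H :: 'a pair_pre_digraph. induced_subgraph (with_proj H) (with_proj G) \<and>
            digraph_iso (with_proj H) (with_proj (cycle_graph k)))"
  shows "hadwiger_number G \<ge> chromatic_number G"
proof -
  define E where "E u v \<longleftrightarrow> (u, v) \<in> parcs G" for u v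
  have E: "(\<lambda>u v. (u, v) \<in> parcs G) = E" by (simp add: E_def fun_eq_iff)
  interpret G: pair_graph G by fact
  interpret adjacency E
    by unfold_locales (auto simp: E_def G.arcs_symmetric dest: G.no_loops')
  interpret long_hole_graph E "pverts G" "independence_number G"
  proof
    show "finite (pverts G)" "independence_number G \<ge> 3" using assms(2) by auto
    show "card S \<le> independence_number G" if "S \<subseteq> pverts G" "stable S" for S
    proof -
      have "independent_set G S" using that by (simp add: independent_set_def stable_def E_def)
      then show ?thesis unfolding independence_number_def
        using independence_number_wf(1)[OF assms(1)] by (intro Max_ge) auto
    qed
    show "2 * int (independence_number G) \<le> k" if h: "hole k c" "range c \<subseteq> pverts G" for k c
    proof (rule ccontr)
      \<comment> \<open>A hole shorter than \<open>2 * independence_number G\<close> would be one of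
        the excluded induced cycles.\<close>
      assume "\<not> ?thesis"
      moreover have "k \<ge> 4" using h by (simp add: hole_def)
      ultimately have "4 \<le> nat k \<and> nat k \<le> 2 * independence_number G - 1" by auto
      moreover have "adjacency (\<lambda>u v. (u, v) \<in> parcs G)" unfolding E by (rule adjacency_axioms)
      ultimately show False
        using assms(3) hole_induced_cycle[OF assms(1), of k c] h unfolding E by blast
    qed
  qed
  obtain Q \<R> where p: "clique_packing (pverts G) Q \<R>"
    and col: "colourable (pverts G) (card Q + card \<R>)"
    using clique_packing_exists[OF subset_refl] by blast
  note p' = p[unfolded clique_packing_def]
  \<comment> \<open>The branch sets are the single vertices of the clique together with the
    dominating sets.\<close>
  define P where "P = (\<lambda>q. {q}) ` Q \<union> \<R>"
  have RV: "R \<subseteq> pverts G" "R \<inter> Q = {}" "connected_set E R" "dominates R (pverts G)" "R \<noteq> {}"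
    if "R \<in> \<R>" for R
    using p' that by (auto simp: connected_set_def)
  have fQ: "finite Q" using p' finite_subset[OF _ G.pair_finite_verts] by blast
  have "card P = card Q + card \<R>"
  proof -
    have "card ((\<lambda>q. {q}) ` Q) = card Q" by (rule card_image) simp
    moreover have "(\<lambda>q. {q}) ` Q \<inter> \<R> = {}" using RV(2) by blast
    ultimately show ?thesis unfolding P_def using fQ p' by (simp add: card_Un_disjoint)
  qed
  \<comment> \<open>\<open>X\<close> is nonempty and disjoint from \<open>R\<close>, so any vertex
    of \<open>X\<close> has a neighbour in the dominating set \<open>R\<close>.\<close>
  have touch: "\<exists>x\<in>X. \<exists>y\<in>R. E x y" if XR: "X \<in> P" "R \<in> \<R>" "X \<noteq> R" for X R
  proof -
    have "X \<subseteq> pverts G \<and> X \<noteq> {} \<and> X \<inter> R = {}"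
    proof (cases "X \<in> \<R>")
      case True
      then show ?thesis using RV(1,5)[OF True] p' XR by blast
    next
      case False
      then obtain q where "X = {q}" "q \<in> Q" using XR by (auto simp: P_def)
      then show ?thesis using RV(2)[OF XR(2)] p' by blast
    qed
    then show ?thesis using RV(4)[OF XR(2)] unfolding dominates_def by blast
  qed
  have "graph_minor (complete_graph (card P)) G"
  proof (rule complete_minor_of_branch_sets[OF assms(1)], unfold E E_def[symmetric])
    show "\<Union>P \<subseteq> pverts G" using RV(1) p' by (auto simp: P_def)
    show "X \<inter> Y = {}" if "X \<in> P" "Y \<in> P" "X \<noteq> Y" for X Y
    proof (cases "X \<in> \<R> \<and> Y \<in> \<R>")
      case True
      then show ?thesis using p' that by blast
    next
      case False
      then show ?thesis using that RV(2)[of X] RV(2)[of Y] by (auto simp: P_def)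
    qed
    show "connected_set E X" if "X \<in> P" for X
      using that RV(3) by (auto simp: P_def connected_set_singleton)
    show "\<exists>x\<in>X. \<exists>y\<in>Y. E x y" if XY: "X \<in> P" "Y \<in> P" "X \<noteq> Y" for X Y
    proof -
      consider "Y \<in> \<R>" | "X \<in> \<R>" | x y where "X = {x}" "Y = {y}" "x \<in> Q" "y \<in> Q"
        using XY by (auto simp: P_def)
      then show ?thesis
      proof cases
        case 1
        then show ?thesis using touch XY by blast
      next
        case 2
        then have "\<exists>y\<in>Y. \<exists>x\<in>X. E y x" using touch[of Y X] XY by auto
        then show ?thesis using adj_sym by metis
      next
        case 3
        then show ?thesis using p' XY by (auto simp: clique_def)
      qed
    qed
  qed
  then have "card Q + card \<R> \<le> hadwiger_number G"
    unfolding hadwiger_number_def \<open>card P = _\<close>[symmetric]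
    using hadwiger_number_wf(1)[OF assms(1)] by (intro Max_ge) auto
  moreover have "chromatic_number G \<le> card Q + card \<R>"
    unfolding chromatic_number_def
  proof (rule Least_le)
    obtain f where "\<forall>v\<in>pverts G. f v < card Q + card \<R>"
      "\<forall>u\<in>pverts G. \<forall>v\<in>pverts G. E u v \<longrightarrow> f u \<noteq> f v"
      using col unfolding colourable_def by meson
    then have "proper_colouring G (card Q + card \<R>) f"
      unfolding proper_colouring_def E_def by (auto dest: G.in_arcsD1 G.in_arcsD2)
    then show "\<exists>c. proper_colouring G (card Q + card \<R>) c" by blast
  qed
  ultimately show ?thesis by linarith
qed

end
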